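(* Let $T_s=\operatorname{diag}(1,s,0,0,0,\dots)$ for $0\le s\le1$. Then $$\sqrt2\le\lim_{s\to0^+}\kappa^c_{\mathbb CT_s}\le\tfrac52,$$ while $\kappa^c_{\mathbb CT_0}=1$.
   Context: $T_s$ is the diagonal operator with the indicated entries with respect to an orthonormal basis of a Hilbert space, and $\mathbb CT_s$ is the subspace of its scalar multiples. For a linear subspace $\mathcal S\subset\mathcal B(\mathcal H)$ and $x\in\mathcal H$, $P_{\mathcal Sx}$ is the orthogonal projection onto $\overline{\mathcal Sx}$, and $\beta_{\mathcal S}(T)=\sup_{\|x\|=1}\|P_{\mathcal Sx}^\perp Tx\|$. The hyperreflexivity constant $\kappa_{\mathcal S}$ is the optimal constant $C$ with $\operatorname{dist}(T,\mathcal S)\le C\,\beta_{\mathcal S}(T)$ for all $T\in\mathcal B(\mathcal H)$. For a subspace $\mathcal S$ closed in the weak operator topology (WOT), $\kappa^c_{\mathcal S}$ is the hyperreflexivity constant of $\mathcal S\,\bar\otimes\,\mathcal B(\mathcal K)\subset\mathcal B(\mathcal H\otimes\mathcal K)$ (the WOT-closure of the spatial tensor product), where $\mathcal K$ is a separable (infinite-dimensional) Hilbert space. *)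

theory Defs
  imports "HOL-Analysis.Analysis"
begin

section \<open>Complex Hilbert spaces\<close>

class complex_vector = real_vector +
  fixes scaleC :: "complex \<Rightarrow> 'a \<Rightarrow> 'a" (infixr "*\<^sub>C" 75)
  assumes scaleC_add_right: "c *\<^sub>C (x + y) = c *\<^sub>C x + c *\<^sub>C y"
    and scaleC_add_left: "(c + d) *\<^sub>C x = c *\<^sub>C x + d *\<^sub>C x"
    and scaleC_scaleC: "c *\<^sub>C d *\<^sub>C x = (c * d) *\<^sub>C x"
    and scaleC_of_real: "complex_of_real r *\<^sub>C x = r *\<^sub>R x"

class complex_normed_vector = complex_vector + real_normed_vector +
  assumes norm_scaleC: "norm (c *\<^sub>C x) = cmod c * norm x"

text \<open>The inner product is linear in its first argument; its real part is the
  real inner product of \<^class>\<open>real_inner\<close>, which determines the norm.\<close>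

class complex_inner = complex_normed_vector + real_inner +
  fixes cinner :: "'a \<Rightarrow> 'a \<Rightarrow> complex"
  assumes cinner_commute: "cinner x y = cnj (cinner y x)"
    and cinner_add_left: "cinner (x + y) z = cinner x z + cinner y z"
    and cinner_scaleC_left: "cinner (c *\<^sub>C x) y = c * cinner x y"
    and Re_cinner: "Re (cinner x y) = inner x y"

class chilbert_space = complex_inner + complete_space

global_interpretation complex_vector: vector_space "scaleC :: complex \<Rightarrow> 'a \<Rightarrow> 'a::complex_vector"
  defines cspan = complex_vector.span
proof
  show "1 *\<^sub>C x = x" for x :: 'a
    using scaleC_of_real[of 1 x] by simp
qed (fact scaleC_add_right scaleC_add_left scaleC_scaleC)+

instantiation blinfun :: (real_normed_vector, complex_normed_vector) complex_vector
begin

lift_definition scaleC_blinfun :: "complex \<Rightarrow> 'a \<Rightarrow>\<^sub>L 'b \<Rightarrow> 'a \<Rightarrow>\<^sub>L 'b"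
  is "\<lambda>c f x. c *\<^sub>C f x"
proof -
  fix c :: complex and f :: "'a \<Rightarrow> 'b"
  assume f: "bounded_linear f"
  have comm: "c *\<^sub>C r *\<^sub>R y = r *\<^sub>R c *\<^sub>C y" for r and y :: 'b
    by (simp add: scaleC_of_real[symmetric] scaleC_scaleC mult.commute)
  have "norm (c *\<^sub>C y) \<le> norm y * cmod c" for y :: 'b
    by (simp add: norm_scaleC)
  then have "bounded_linear (\<lambda>y::'b. c *\<^sub>C y)"
    by (intro bounded_linear_intro[where K = "cmod c"]) (auto simp: scaleC_add_right comm)
  from bounded_linear_compose[OF this f] show "bounded_linear (\<lambda>x. c *\<^sub>C f x)" .
qed

instance
  by standard (transfer; simp add: scaleC_add_right scaleC_add_left scaleC_scaleC scaleC_of_real)+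

end

definition orthonormal_basis :: "(nat \<Rightarrow> 'a::complex_inner) \<Rightarrow> bool" where
  "orthonormal_basis e \<longleftrightarrow>
     (\<forall>i j. cinner (e i) (e j) = (if i = j then 1 else 0)) \<and> closure (cspan (range e)) = UNIV"


section \<open>Bounded operators\<close>

text \<open>The elements of \<^typ>\<open>'a \<Rightarrow>\<^sub>L 'b\<close> are the bounded \<^emph>\<open>real\<close>-linear maps;
  \<open>bounded_ops\<close> is $\mathcal{B}(\mathcal{H})$, with the operator norm inherited from that type.\<close>

definition bounded_ops :: "('a::complex_normed_vector \<Rightarrow>\<^sub>L 'a) set" where
  "bounded_ops = {T. \<forall>c x. blinfun_apply T (c *\<^sub>C x) = c *\<^sub>C blinfun_apply T x}"

definition wot :: "('a::complex_inner \<Rightarrow>\<^sub>L 'a) topology" where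
  "wot = topology_generated_by
     {{T \<in> bounded_ops. cinner (blinfun_apply T x) y \<in> U} | x y U. open U}"

definition diag_op :: "(nat \<Rightarrow> 'a::complex_inner) \<Rightarrow> (nat \<Rightarrow> complex) \<Rightarrow> 'a \<Rightarrow>\<^sub>L 'a" where
  "diag_op e d = (THE T. T \<in> bounded_ops \<and> (\<forall>n. blinfun_apply T (e n) = d n *\<^sub>C e n))"

definition orth_proj :: "'a::complex_inner set \<Rightarrow> 'a \<Rightarrow> 'a" where
  "orth_proj M v = (THE p. p \<in> M \<and> (\<forall>m\<in>M. cinner (v - p) m = 0))"


section \<open>Hyperreflexivity\<close>

definition hr_beta :: "('a::complex_inner \<Rightarrow>\<^sub>L 'a) set \<Rightarrow> ('a \<Rightarrow>\<^sub>L 'a) \<Rightarrow> real" where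
  "hr_beta S T = (SUP x\<in>{x. norm x = 1}.
     norm (blinfun_apply T x
       - orth_proj (closure ((\<lambda>A. blinfun_apply A x) ` S)) (blinfun_apply T x)))"

text \<open>The value is \<open>\<infinity>\<close> if no constant works.\<close>

definition hr_const :: "('a::complex_inner \<Rightarrow>\<^sub>L 'a) set \<Rightarrow> ereal" where
  "hr_const S = (INF C\<in>{C::real. 0 \<le> C \<and> (\<forall>T\<in>bounded_ops. infdist T S \<le> C * hr_beta S T)}. ereal C)"


section \<open>Tensor products and complete hyperreflexivity\<close>

text \<open>\<open>hilbert_tensor t\<close>: the Hilbert space \<open>'c\<close> together with the map \<open>t\<close>, \<open>t x y\<close> being
  the elementary tensor of \<open>x\<close> and \<open>y\<close>, is the Hilbert space tensor product of \<open>'a\<close> and \<open>'b\<close>.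
  These conditions determine it up to a unique unitary.\<close>

definition hilbert_tensor ::
  "('a::chilbert_space \<Rightarrow> 'b::chilbert_space \<Rightarrow> 'c::chilbert_space) \<Rightarrow> bool" where
  "hilbert_tensor t \<longleftrightarrow>
     (\<forall>x x' y. t (x + x') y = t x y + t x' y) \<and>
     (\<forall>x y y'. t x (y + y') = t x y + t x y') \<and>
     (\<forall>c x y. t (c *\<^sub>C x) y = c *\<^sub>C t x y \<and> t x (c *\<^sub>C y) = c *\<^sub>C t x y) \<and>
     (\<forall>x x' y y'. cinner (t x y) (t x' y') = cinner x x' * cinner y y') \<and>
     closure (cspan {t x y | x y. True}) = UNIV"

text \<open>The condition on \<open>W\<close> below says that \<open>W\<close> is the operator \<open>A \<otimes> B\<close>.\<close>

definition wot_tensor ::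
  "('a::chilbert_space \<Rightarrow> 'b::chilbert_space \<Rightarrow> 'c::chilbert_space) \<Rightarrow>
   ('a \<Rightarrow>\<^sub>L 'a) set \<Rightarrow> ('b \<Rightarrow>\<^sub>L 'b) set \<Rightarrow> ('c \<Rightarrow>\<^sub>L 'c) set" where
  "wot_tensor t S R = wot closure_of cspan
     {W \<in> bounded_ops. \<exists>A\<in>S. \<exists>B\<in>R. \<forall>x y.
        blinfun_apply W (t x y) = t (blinfun_apply A x) (blinfun_apply B y)}"

definition complete_hr_const ::
  "('a::chilbert_space \<Rightarrow> 'b::chilbert_space \<Rightarrow> 'c::chilbert_space) \<Rightarrow> ('a \<Rightarrow>\<^sub>L 'a) set \<Rightarrow> ereal" where
  "complete_hr_const t S = hr_const (wot_tensor t S bounded_ops)"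

definition diag_T :: "(nat \<Rightarrow> 'a::complex_inner) \<Rightarrow> real \<Rightarrow> 'a \<Rightarrow>\<^sub>L 'a" where
  "diag_T e s = diag_op e (\<lambda>n. if n = 0 then 1 else if n = 1 then complex_of_real s else 0)"

definition scalar_multiples :: "'a::complex_vector \<Rightarrow> 'a set" where
  "scalar_multiples T = range (\<lambda>c::complex. c *\<^sub>C T)"

end

theory Submission
  imports Defs
begin

text \<open>The limit is in fact \<open>sqrt 2\<close>. Identify $H \otimes K$ with a direct sum of copies of $K$, so
  that the amplified space consists of the operators $\mathrm{diag}(B, sB, 0, \dots)$; let $P$ be
  the projection onto the first summand and $Q = 1 - P$.

  Upper bound: let $\beta = \beta(T)$ and subtract an element of the space so that $PTP = 0$.
  Vectors in the range of $P$ give $\|QTP\| \le \beta$, vectors in the range of $Q$ give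
  $\|PTQ\| \le \beta$, and $y + \sqrt{s}\,(y_1, 0, 0, \dots)$ with $y = (0, y_1, y_2, \dots)$ gives
  $\|QTQ\| \le (1 + O(\sqrt{s}))\,\beta$. Hence $\|QT\|$ and $\|TQ\|$ are at most
  $\sqrt{2}\,(1 + O(\sqrt{s}))\,\beta$, and by Parrott's theorem some $B$ achieves this bound for the
  distance from $T$ to $\mathrm{diag}(B, 0, 0, \dots)$, which is within $s\|B\|$ of
  $\mathrm{diag}(B, sB, 0, \dots)$. For $s = 0$ Parrott's theorem applies with constant 1.

  Lower bound: for orthonormal $u, v$ in $K$ the operator
  $Tx = (0, (\langle x_0, u\rangle + \langle x_1, v\rangle) u, 0, \dots)$ satisfies $\beta(T) \le 1$
  and has distance at least $2/(\sqrt{2} + s)$ from the space.\<close>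

section \<open>Adjoints\<close>

text \<open>The representing vector is the minimizer over \<open>M\<close> of
  \<open>(norm x)^2 - 2 * f x\<close>, whose first variation vanishes along \<open>M\<close>. With
  \<open>M = UNIV\<close> this yields adjoints, and with \<open>f = inner v\<close> it yields
  orthogonal projections.\<close>

lemma riesz_on_closed_subspace:
  fixes M :: "'a::{real_inner,complete_space} set"
  assumes "closed M" "subspace M" "bounded_linear f"
  obtains p where "p \<in> M" "\<And>m. m \<in> M \<Longrightarrow> inner p m = f m"
proof -
  interpret f: bounded_linear f by fact
  obtain K where K: "\<And>x. norm (f x) \<le> norm x * K" using f.bounded by blast
  define g where "g x = (norm x)\<^sup>2 - 2 * f x" for x
  have g_below: "g x \<ge> - K\<^sup>2" for x
  proof -
    have "f x \<le> norm x * K" using K[of x] by simp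
    moreover have "(norm x - K)\<^sup>2 \<ge> 0" by simp
    ultimately show ?thesis unfolding g_def by (simp add: power2_diff)
  qed
  define \<delta> where "\<delta> = Inf (g ` M)"
  have bdd: "bdd_below (g ` M)" using g_below by (intro bdd_belowI[of _ "- K\<^sup>2"]) auto
  have M0: "0 \<in> M" using assms(2) by (rule subspace_0)
  have low: "\<delta> \<le> g x" if "x \<in> M" for x
    unfolding \<delta>_def using bdd that by (auto intro: cInf_lower)
  have "\<exists>x\<in>M. g x < \<delta> + 1 / Suc n" for n
  proof -
    have "Inf (g ` M) < \<delta> + 1 / Suc n" unfolding \<delta>_def by simp
    then show ?thesis using cInf_lessD[of "g ` M"] M0 by blast
  qed
  then obtain X where X: "\<And>n. X n \<in> M" "\<And>n. g (X n) < \<delta> + 1 / Suc n" by metis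
  \<comment> \<open>Parallelogram law: the linear terms in \<open>f\<close> cancel, so a minimizing
    sequence is Cauchy.\<close>
  have para: "(norm (x - y))\<^sup>2 = 2 * g x + 2 * g y - 4 * g ((1/2) *\<^sub>R (x + y))" for x y
    unfolding g_def by (simp add: f.add f.scaleR power2_norm_eq_inner inner_simps field_simps inner_commute)
  have close: "(norm (X m - X n))\<^sup>2 \<le> 2 / Suc m + 2 / Suc n" for m n
  proof -
    have "(1/2) *\<^sub>R (X m + X n) \<in> M" using X(1) assms(2) by (simp add: subspace_add subspace_scale)
    then have "g ((1/2) *\<^sub>R (X m + X n)) \<ge> \<delta>" by (rule low)
    then show ?thesis unfolding para using X(2)[of m] X(2)[of n] by simp
  qed
  have "Cauchy X"
  proof (rule metric_CauchyI)
    fix e :: real assume e: "e > 0"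
    obtain N where N: "4 / e\<^sup>2 < real N" using reals_Archimedean2 by blast
    have "dist (X m) (X n) < e" if "m \<ge> N" "n \<ge> N" for m n
    proof -
      have pos: "real N > 0" using N e by (smt (verit) divide_pos_pos zero_less_power)
      have "2 / Suc m < 2 / N" "2 / Suc n < 2 / N" using that pos by (auto intro!: divide_strict_left_mono)
      moreover have "4 / real N < e\<^sup>2" using N e pos by (simp add: field_simps)
      ultimately have "(norm (X m - X n))\<^sup>2 < e\<^sup>2" using close[of m n] by simp
      then show ?thesis using e by (simp add: dist_norm power2_less_imp_less)
    qed
    then show "\<exists>N. \<forall>m\<ge>N. \<forall>n\<ge>N. dist (X m) (X n) < e" by blast
  qed
  then obtain p where p: "X \<longlonglongrightarrow> p" using Cauchy_convergent convergent_def by blast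
  have pM: "p \<in> M" using closed_sequentially[OF assms(1) X(1) p] .
  have "(\<lambda>n. g (X n)) \<longlonglongrightarrow> g p"
    unfolding g_def by (intro tendsto_intros p f.tendsto)
  moreover have "(\<lambda>n. \<delta> + 1 / Suc n) \<longlonglongrightarrow> \<delta> + 0"
    by (intro tendsto_intros LIMSEQ_Suc[OF lim_inverse_n'])
  ultimately have gp: "g p \<le> \<delta>"
    using X(2) by (intro LIMSEQ_le[of "\<lambda>n. g (X n)" "g p" "\<lambda>n. \<delta> + 1 / Suc n"]) (auto intro: less_imp_le)
  have "inner p m = f m" if m: "m \<in> M" for m
  proof -
    define d where "d = inner p m - f m"
    \<comment> \<open>The summand 1 keeps \<open>N\<close> positive even for \<open>m = 0\<close>;
      \<open>t\<close> then minimizes \<open>t^2 * N + 2 * t * d\<close>.\<close>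
    define N where "N = (norm m)\<^sup>2 + 1"
    define t where "t = - d / N"
    have N: "N > 0" by (simp add: N_def add_nonneg_pos)
    have "p + t *\<^sub>R m \<in> M" using pM m assms(2) by (simp add: subspace_add subspace_scale)
    then have "g p \<le> g (p + t *\<^sub>R m)" using gp low by force
    then have "0 \<le> t\<^sup>2 * (norm m)\<^sup>2 + 2 * t * d"
      unfolding g_def d_def power2_norm_eq_inner
      by (simp add: f.add f.scaleR inner_simps inner_commute power2_eq_square algebra_simps)
    also have "\<dots> \<le> t\<^sup>2 * N + 2 * t * d"
      by (simp add: N_def algebra_simps)
    also have "\<dots> = - d\<^sup>2 / N"
      using N unfolding t_def by (simp add: field_simps power2_eq_square)
    finally have "d\<^sup>2 \<le> 0" using N by (simp add: divide_le_0_iff)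
    then show ?thesis unfolding d_def by simp
  qed
  then show ?thesis using that pM by blast
qed

section \<open>Complex inner products and complex-linear operators\<close>

lemma cinner_add_right: "cinner x (y + z) = cinner x y + cinner x z"
  by (metis cinner_add_left cinner_commute complex_cnj_add)

lemma cinner_scaleC_right: "cinner x (c *\<^sub>C y) = cnj c * cinner x y"
  by (metis cinner_commute cinner_scaleC_left complex_cnj_mult)

lemma cinner_scaleR_left: "cinner (r *\<^sub>R x) y = of_real r * cinner x y"
  by (metis cinner_scaleC_left scaleC_of_real)

lemma cinner_scaleR_right: "cinner x (r *\<^sub>R y) = of_real r * cinner x y"
  by (metis cinner_scaleC_right complex_cnj_complex_of_real scaleC_of_real)

lemma cinner_zero_left [simp]: "cinner 0 y = 0"
  using cinner_scaleR_left[of 0 0 y] by simp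

lemma cinner_zero_right [simp]: "cinner x 0 = 0"
  using cinner_scaleR_right[of x 0 0] by simp

lemma cinner_diff_left: "cinner (x - y) z = cinner x z - cinner y z"
  using cinner_add_left[of "x - y" y z] by simp

lemma Im_cinner: "Im (cinner x y) = inner x (\<i> *\<^sub>C y)"
  by (simp add: Re_cinner[symmetric] cinner_scaleC_right)

lemma cinner_self: "cinner x x = of_real ((norm x)\<^sup>2)"
proof -
  have "Im (cinner x x) = 0"
    using arg_cong[OF cinner_commute[of x x], of Im] by simp
  then show ?thesis
    by (simp add: complex_eq_iff Re_cinner power2_norm_eq_inner)
qed

lemma cinner_eq_zero_iff_inner:
  assumes "\<And>c. c *\<^sub>C y \<in> M" "\<And>m. m \<in> M \<Longrightarrow> inner x m = 0"
  shows "cinner x y = 0"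
  using assms(1)[of 1] assms by (auto simp: complex_eq_iff Re_cinner Im_cinner)

lemma cinner_eqI: 
  fixes x y :: "'a::complex_inner"
  assumes "\<And>z. cinner x z = cinner y z"
  shows "x = y"
proof -
  have "inner (x - y) (x - y) = 0"
    using assms[of "x - y"] by (simp add: Re_cinner[symmetric] cinner_diff_left)
  then show ?thesis by simp
qed

lemma norm_cinner_le: "norm (cinner x y) \<le> norm x * norm y"
proof (cases "cinner x y = 0")
  case False
  \<comment> \<open>Multiplication by the unimodular number \<open>c\<close> rotates
    \<open>cinner x y\<close> onto the positive real axis, which reduces the claim to the real
    Cauchy-Schwarz inequality.\<close>
  define c where "c = cnj (sgn (cinner x y))"
  have c: "norm c = 1" using False by (simp add: c_def norm_sgn)
  have "c * cinner x y = of_real (norm (cinner x y))"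
    using False by (simp add: c_def sgn_eq field_simps power2_eq_square flip: complex_norm_square)
  then have "norm (cinner x y) = inner (c *\<^sub>C x) y"
    by (metis Re_cinner Re_complex_of_real cinner_scaleC_left)
  also have "\<dots> \<le> norm (c *\<^sub>C x) * norm y" by (rule norm_cauchy_schwarz)
  finally show ?thesis by (simp add: norm_scaleC c)
qed simp

lemma scaleC_scaleR: "c *\<^sub>C r *\<^sub>R x = r *\<^sub>R c *\<^sub>C (x::'a::complex_vector)"
  by (simp add: scaleC_of_real[symmetric] scaleC_scaleC mult.commute)

text \<open>Unlike \<open>bounded_ops\<close>, this also covers operators between two different
  spaces, such as the isometries from K into the tensor product.\<close>

definition clinear_op :: "('a::complex_normed_vector \<Rightarrow>\<^sub>L 'b::complex_normed_vector) \<Rightarrow> bool" where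
  "clinear_op A \<longleftrightarrow> (\<forall>c x. blinfun_apply A (c *\<^sub>C x) = c *\<^sub>C blinfun_apply A x)"

lemma clinear_opD: "clinear_op A \<Longrightarrow> blinfun_apply A (c *\<^sub>C x) = c *\<^sub>C blinfun_apply A x"
  by (simp add: clinear_op_def)

lemma bounded_ops_iff: "T \<in> bounded_ops \<longleftrightarrow> clinear_op T"
  by (simp add: bounded_ops_def clinear_op_def)

lemma clinear_op_compose: "clinear_op A \<Longrightarrow> clinear_op B \<Longrightarrow> clinear_op (A o\<^sub>L B)"
  by (simp add: clinear_op_def)

lemma clinear_op_add: "clinear_op A \<Longrightarrow> clinear_op B \<Longrightarrow> clinear_op (A + B)"
  by (simp add: clinear_op_def blinfun.bilinear_simps scaleC_add_right)

lemma clinear_op_diff: "clinear_op A \<Longrightarrow> clinear_op B \<Longrightarrow> clinear_op (A - B)"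
  by (simp add: clinear_op_def blinfun.bilinear_simps complex_vector.scale_right_diff_distrib)

lemma clinear_op_scaleR: "clinear_op A \<Longrightarrow> clinear_op (r *\<^sub>R A)"
  by (simp add: clinear_op_def blinfun.bilinear_simps scaleC_scaleR)

lemma clinear_op_scaleC: "clinear_op A \<Longrightarrow> clinear_op (c *\<^sub>C A)"
  by (simp add: clinear_op_def scaleC_blinfun.rep_eq scaleC_scaleC mult.commute)

lemma clinear_op_id: "clinear_op id_blinfun"
  by (simp add: clinear_op_def)

lemma clinear_op_zero: "clinear_op 0"
  by (simp add: clinear_op_def)

lemmas clinear_op_intros = clinear_op_compose clinear_op_add clinear_op_diff clinear_op_scaleR
  clinear_op_scaleC clinear_op_id clinear_op_zero

text \<open>The adjoint is taken for the real inner product. For a complex-linear operator it is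
  also the complex adjoint, by \<open>cinner_hilbert_adjoint\<close>.\<close>

definition hilbert_adjoint ::
  "('a::{real_inner,complete_space} \<Rightarrow>\<^sub>L 'b::real_inner) \<Rightarrow> 'b \<Rightarrow>\<^sub>L 'a" where
  "hilbert_adjoint A = (SOME A'. \<forall>x y. inner (blinfun_apply A x) y = inner x (blinfun_apply A' y))"

lemma inner_hilbert_adjoint:
  fixes A :: "'a::{real_inner,complete_space} \<Rightarrow>\<^sub>L 'b::real_inner"
  shows "inner (blinfun_apply A x) y = inner x (blinfun_apply (hilbert_adjoint A) y)"
proof -
  have "\<exists>p. \<forall>x. inner p x = inner (blinfun_apply A x) y" for y
  proof -
    have "bounded_linear (\<lambda>x. inner (blinfun_apply A x) y)"
      by (intro bounded_linear_intros)
    then show ?thesis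
      using riesz_on_closed_subspace[OF closed_UNIV subspace_UNIV] by (metis UNIV_I)
  qed
  then obtain f where f: "\<And>x y. inner (f y) x = inner (blinfun_apply A x) y" by metis
  have "bounded_linear f"
  proof (rule bounded_linear_intro[where K = "norm A"])
    show "f (x + y) = f x + f y" for x y
      by (rule vector_eq_rdot[THEN iffD1]) (simp add: f inner_simps)
    show "f (r *\<^sub>R x) = r *\<^sub>R f x" for r x
      by (rule vector_eq_rdot[THEN iffD1]) (simp add: f inner_simps)
    show "norm (f y) \<le> norm y * norm A" for y
    proof -
      have "norm (f y) * norm (f y) = inner (blinfun_apply A (f y)) y"
        by (simp flip: f add: power2_norm_eq_inner power2_eq_square[symmetric])
      also have "\<dots> \<le> norm (blinfun_apply A (f y)) * norm y" by (rule norm_cauchy_schwarz)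
      also have "\<dots> \<le> (norm A * norm (f y)) * norm y"
        by (intro mult_right_mono norm_blinfun) simp
      finally have "norm (f y) * norm (f y) \<le> norm (f y) * (norm y * norm A)"
        by (simp add: mult_ac)
      then show ?thesis
        by (cases "f y = 0") (auto dest: mult_left_le_imp_le)
    qed
  qed
  then have "\<forall>x y. inner (blinfun_apply A x) y = inner x (blinfun_apply (Blinfun f) y)"
    by (metis bounded_linear_Blinfun_apply f inner_commute)
  then show ?thesis
    unfolding hilbert_adjoint_def by (rule someI2) blast
qed

lemma cinner_hilbert_adjoint:
  assumes "clinear_op (A :: 'a::chilbert_space \<Rightarrow>\<^sub>L 'b::chilbert_space)"
  shows "cinner (blinfun_apply A x) y = cinner x (blinfun_apply (hilbert_adjoint A) y)"
proof -
  have re: "Re (cinner (blinfun_apply A x) y) = Re (cinner x (blinfun_apply (hilbert_adjoint A) y))" for x y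
    by (simp add: Re_cinner inner_hilbert_adjoint)
  \<comment> \<open>The imaginary part is recovered from the real identity at \<open>\<i>\<close>
    times \<open>x\<close>.\<close>
  have "Im (cinner (blinfun_apply A x) y) = Im (cinner x (blinfun_apply (hilbert_adjoint A) y))"
    using re[of "\<i> *\<^sub>C x" y] assms by (simp add: clinear_opD cinner_scaleC_left)
  with re show ?thesis by (simp add: complex_eq_iff)
qed

lemma clinear_op_hilbert_adjoint:
  assumes "clinear_op (A :: 'a::chilbert_space \<Rightarrow>\<^sub>L 'b::chilbert_space)"
  shows "clinear_op (hilbert_adjoint A)"
  unfolding clinear_op_def
proof (intro allI cinner_eqI)
  fix c x z
  show "cinner (blinfun_apply (hilbert_adjoint A) (c *\<^sub>C x)) z = cinner (c *\<^sub>C blinfun_apply (hilbert_adjoint A) x) z"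
    using cinner_hilbert_adjoint[OF assms, symmetric]
    by (metis (no_types) cinner_commute cinner_scaleC_left cinner_scaleC_right)
qed

section \<open>Parrott's theorem\<close>

text \<open>\<open>G\<close> is the inverse of 1 - E. Its values are the fixed points of w -> E w +
  c given by Banach's theorem, and uniqueness of the fixed points makes \<open>G\<close>
  linear.\<close>

lemma contraction_resolvent:
  fixes E :: "'a::chilbert_space \<Rightarrow>\<^sub>L 'a"
  assumes "clinear_op E" "0 \<le> q" "q < 1" "\<And>x. norm (blinfun_apply E x) \<le> q * norm x"
  obtains G where "clinear_op G" "\<And>c. blinfun_apply G c = blinfun_apply E (blinfun_apply G c) + c"
proof -
  have "\<exists>!w. blinfun_apply E w + c = w" for c
  proof (rule banach_fix_type[OF assms(2,3)])
    show "\<forall>x y. dist (blinfun_apply E x + c) (blinfun_apply E y + c) \<le> q * dist x y"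
      using assms(4) by (simp add: dist_norm flip: blinfun.diff_right)
  qed
  then have uniq: "\<And>c. \<exists>!w. blinfun_apply E w + c = w" .
  define g where "g c = (THE w. blinfun_apply E w + c = w)" for c
  have g: "blinfun_apply E (g c) + c = g c" for c
    unfolding g_def using theI'[OF uniq[of c]] .
  have gI: "g c = w" if "blinfun_apply E w + c = w" for c w
    using uniq[of c] g[of c] that by blast
  have "bounded_linear g"
  proof (rule bounded_linear_intro[where K = "1 / (1 - q)"])
    show "g (x + y) = g x + g y" for x y
      using arg_cong2[OF g[of x] g[of y], of "(+)"] by (intro gI) (simp add: blinfun.add_right algebra_simps)
    show "g (r *\<^sub>R x) = r *\<^sub>R g x" for r x
      by (intro gI) (simp add: blinfun.scaleR_right g flip: scaleR_add_right)
    show "norm (g x) \<le> norm x * (1 / (1 - q))" for x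
    proof -
      have "norm (g x) \<le> q * norm (g x) + norm x"
        using norm_triangle_ineq[of "blinfun_apply E (g x)" x] assms(4)[of "g x"] g[of x] by simp
      then show ?thesis using assms(3) by (simp add: field_simps)
    qed
  qed
  note app = bounded_linear_Blinfun_apply[OF this]
  have "g (c *\<^sub>C x) = c *\<^sub>C g x" for c x
    by (intro gI) (simp add: clinear_opD[OF assms(1)] g flip: scaleC_add_right)
  then show ?thesis
    by (intro that[of "Blinfun g"]) (simp_all add: clinear_op_def app g)
qed

text \<open>With $P = JJ^*$ and $Q = 1 - P$, write $T$ as a block matrix and let $R = PTQ$, $C = QTP$ and
  $D = QTQ$. Then $-RD^*(1 - DD^*)^{-1}C$ completes the three blocks to a contraction.\<close>

lemma parrott_strict:
  fixes J :: "'k::chilbert_space \<Rightarrow>\<^sub>L 'x::chilbert_space"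
  assumes J: "clinear_op J" "\<And>x y. inner (blinfun_apply J x) (blinfun_apply J y) = inner x y"
    and T: "clinear_op T"
    and Q: "\<And>x. Q x = x - blinfun_apply J (blinfun_apply (hilbert_adjoint J) x)"
    and "q < 1"
    and row: "\<And>x. norm (Q (blinfun_apply T x)) \<le> q * norm x"
    and col: "\<And>x. norm (blinfun_apply T (Q x)) \<le> q * norm (Q x)"
  obtains B where "clinear_op B" "norm (T - (J o\<^sub>L B o\<^sub>L hilbert_adjoint J)) \<le> 1"
proof -
  define J' where "J' = hilbert_adjoint J"
  define T' where "T' = hilbert_adjoint T"
  define P where "P x = blinfun_apply J (blinfun_apply J' x)" for x
  \<comment> \<open>The hypotheses allow a negative \<open>q\<close>, while the fixed point argument
    needs a factor in [0, 1).\<close>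
  define q' where "q' = max q 0"
  have q': "0 \<le> q'" "q' < 1" using \<open>q < 1\<close> by (auto simp: q'_def)
  have row: "norm (Q (blinfun_apply T x)) \<le> q' * norm x" for x
    by (rule order_trans[OF row]) (auto simp: q'_def intro: mult_right_mono)
  have col: "norm (blinfun_apply T (Q x)) \<le> q' * norm (Q x)" for x
    by (rule order_trans[OF col]) (auto simp: q'_def intro: mult_right_mono)
  have cl: "clinear_op J'" "clinear_op T'"
    unfolding J'_def T'_def using J(1) T by (auto intro: clinear_op_hilbert_adjoint)
  have adjJ: "inner (blinfun_apply J x) y = inner x (blinfun_apply J' y)" for x y
    unfolding J'_def by (rule inner_hilbert_adjoint)
  have adjT: "inner (blinfun_apply T x) y = inner x (blinfun_apply T' y)" for x y
    unfolding T'_def by (rule inner_hilbert_adjoint)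
  have J'J: "blinfun_apply J' (blinfun_apply J x) = x" for x
    by (rule vector_eq_ldot[THEN iffD1]) (simp add: adjJ[symmetric] J(2))
  have QP: "Q x = x - P x" for x by (simp add: Q P_def J'_def)
  have PP: "P (P x) = P x" for x by (simp add: P_def J'J)
  have lin: "P (x + y) = P x + P y" "P (x - y) = P x - P y" for x y
    by (simp_all add: P_def blinfun.bilinear_simps)
  have QQ: "Q (Q x) = Q x" and PQ: "P (Q x) = 0" and QP0: "Q (P x) = 0" for x
    by (simp_all add: QP lin PP)
  have Qlin: "Q (x + y) = Q x + Q y" "Q (x - y) = Q x - Q y" for x y
    by (simp_all add: QP lin)
  have Psym: "inner (P x) y = inner x (P y)" for x y
    unfolding P_def by (simp add: adjJ) (metis adjJ inner_commute)
  have Qsym: "inner (Q x) y = inner x (Q y)" for x y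
    by (simp add: QP inner_simps Psym)
  have pyth: "(norm x)\<^sup>2 = (norm (P x))\<^sup>2 + (norm (Q x))\<^sup>2" for x
    unfolding power2_norm_eq_inner Qsym Psym QQ PP
    by (simp add: QP inner_simps)
  define QO where "QO = id_blinfun - (J o\<^sub>L J')"
  have QO: "blinfun_apply QO x = Q x" for x
    by (simp add: QO_def QP P_def blinfun.bilinear_simps)
  have clQ: "clinear_op QO" unfolding QO_def by (intro clinear_op_intros J cl)
  \<comment> \<open>T'Q is the adjoint of QT, so it inherits the row bound.\<close>
  have row': "norm (blinfun_apply T' (Q x)) \<le> q' * norm x" for x
  proof -
    let ?y = "blinfun_apply T' (Q x)"
    have "norm ?y * norm ?y = inner (Q (blinfun_apply T ?y)) x"
      by (simp add: Qsym adjT power2_norm_eq_inner flip: power2_eq_square)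
    also have "\<dots> \<le> norm (Q (blinfun_apply T ?y)) * norm x" by (rule norm_cauchy_schwarz)
    also have "\<dots> \<le> (q' * norm ?y) * norm x" by (intro mult_right_mono row) simp
    finally have "norm ?y * norm ?y \<le> norm ?y * (q' * norm x)" by (simp add: mult_ac)
    then show ?thesis using q' by (cases "?y = 0") (auto dest: mult_left_le_imp_le)
  qed
  have Qle: "norm (Q x) \<le> norm x" for x
    using pyth[of x] by (simp add: power2_le_imp_le)
  \<comment> \<open>\<open>E\<close> is D D' for the block D = QTQ with adjoint D' = QT'Q.\<close>
  define E where "E = QO o\<^sub>L T o\<^sub>L QO o\<^sub>L T' o\<^sub>L QO"
  have E: "blinfun_apply E x = Q (blinfun_apply T (Q (blinfun_apply T' (Q x))))" for x
    by (simp add: E_def QO)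
  have clE: "clinear_op E" unfolding E_def by (intro clinear_op_intros T cl clQ)
  have normE: "norm (blinfun_apply E x) \<le> q' * norm x" for x
  proof -
    have "norm (blinfun_apply E x) \<le> q' * norm (Q (blinfun_apply T' (Q x)))"
      unfolding E by (rule row)
    also have "\<dots> \<le> 1 * norm (blinfun_apply T' (Q x))"
      using q' by (intro mult_mono Qle) auto
    also have "\<dots> \<le> q' * norm x" using row' by simp
    finally show ?thesis .
  qed
  obtain G where G: "clinear_op G" "\<And>c. blinfun_apply G c = blinfun_apply E (blinfun_apply G c) + c"
    using contraction_resolvent[OF clE q' normE] by blast
  \<comment> \<open>Subtracting the first summand removes the corner PTP of \<open>T\<close>;
    subtracting the second inserts the corner of the contractive completion.\<close>
  define B where "B = (J' o\<^sub>L T o\<^sub>L J) + (J' o\<^sub>L T o\<^sub>L QO o\<^sub>L T' o\<^sub>L G o\<^sub>L QO o\<^sub>L T o\<^sub>L J)"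
  have clB: "clinear_op B" unfolding B_def by (intro clinear_op_intros T cl clQ J G)
  have "norm (T - (J o\<^sub>L B o\<^sub>L J')) \<le> 1"
  proof (rule norm_blinfun_bound)
    fix z
    define y where "y = Q z"
    \<comment> \<open>Here w = (1 - DD')^{-1} C z and v = y - D'w. The image of \<open>z\<close> has
      P-part PTv and Q-part w + QTv, so the column bound at \<open>v\<close> controls it up to
      \<open>a\<close>. It remains to show that \<open>a\<close> is at most the squared norm of
      Pz.\<close>
    define w where "w = blinfun_apply G (Q (blinfun_apply T (P z)))"
    define v where "v = y - Q (blinfun_apply T' w)"
    define a where "a = (norm w)\<^sup>2 - (norm (Q (blinfun_apply T' w)))\<^sup>2"
    have w: "w = Q (blinfun_apply T (Q (blinfun_apply T' (Q w)))) + Q (blinfun_apply T (P z))"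
      using G(2)[of "Q (blinfun_apply T (P z))"] unfolding w_def E .
    have Qw: "Q w = w" by (subst (1 2) w) (simp add: Qlin QQ)
    note w = w[unfolded Qw]
    have Qv: "Q v = v" unfolding v_def y_def by (simp add: Qlin QQ)
    have zPy: "z = P z + y" by (simp add: y_def QP)
    let ?u = "blinfun_apply (T - (J o\<^sub>L B o\<^sub>L J')) z"
    have u: "?u = blinfun_apply T z - P (blinfun_apply T (P z)) - P (blinfun_apply T (Q (blinfun_apply T' w)))"
      by (simp add: B_def blinfun.bilinear_simps QO P_def w_def)
    have Tz: "blinfun_apply T z = blinfun_apply T (P z) + blinfun_apply T y"
      by (subst zPy) (simp add: blinfun.add_right)
    have Pu: "P ?u = P (blinfun_apply T v)"
      unfolding u Tz v_def by (simp add: lin PP blinfun.bilinear_simps)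
    have "Q ?u = Q (blinfun_apply T (P z)) + Q (blinfun_apply T y)"
      unfolding u Tz by (simp add: Qlin QP0)
    also have "\<dots> = w + Q (blinfun_apply T v)"
      by (subst w) (simp add: v_def Qlin blinfun.bilinear_simps)
    finally have Qu: "Q ?u = w + Q (blinfun_apply T v)" .
    have cross: "inner w (Q (blinfun_apply T v)) = inner (Q (blinfun_apply T' w)) v"
    proof -
      have "inner w (Q (blinfun_apply T v)) = inner w (blinfun_apply T v)"
        by (metis Qsym Qw)
      also have "\<dots> = inner (blinfun_apply T' w) v" by (metis adjT inner_commute)
      also have "\<dots> = inner (Q (blinfun_apply T' w)) v" by (metis Qsym Qv)
      finally show ?thesis .
    qed
    have "norm (blinfun_apply T v) \<le> q' * norm v" using col[of v] by (simp add: Qv)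
    also have "\<dots> \<le> 1 * norm v" using q' by (intro mult_right_mono) auto
    finally have "(norm (blinfun_apply T v))\<^sup>2 \<le> (norm v)\<^sup>2" by (simp add: power_mono)
    then have Tv: "(norm (P (blinfun_apply T v)))\<^sup>2 + (norm (Q (blinfun_apply T v)))\<^sup>2 \<le> (norm v)\<^sup>2"
      using pyth[of "blinfun_apply T v"] by simp
    have "(norm ?u)\<^sup>2 = (norm (P (blinfun_apply T v)))\<^sup>2 + (norm (w + Q (blinfun_apply T v)))\<^sup>2"
      unfolding pyth[of ?u] Pu Qu ..
    also have "\<dots> \<le> (norm v)\<^sup>2 + (norm w)\<^sup>2 + 2 * inner (Q (blinfun_apply T' w)) v"
      using Tv unfolding cross[symmetric] by (simp add: power2_norm_eq_inner inner_simps inner_commute)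
    also have "\<dots> = (norm y)\<^sup>2 + a"
      unfolding a_def v_def by (simp add: power2_norm_eq_inner inner_simps inner_commute)
    finally have total: "(norm ?u)\<^sup>2 \<le> (norm y)\<^sup>2 + a" .
    \<comment> \<open>The equation for \<open>w\<close> says Cz = w - DD'w; pairing it with
      \<open>w\<close> gives \<open>a\<close>.\<close>
    have "a = inner (Q (blinfun_apply T (P z))) w"
    proof -
      have "inner (Q (blinfun_apply T (P z))) w = inner (w - Q (blinfun_apply T (Q (blinfun_apply T' w)))) w"
        by (metis w add_diff_cancel_left')
      also have "\<dots> = inner w w - inner (Q (blinfun_apply T' w)) (blinfun_apply T' w)"
        by (simp add: inner_diff_left Qsym Qw adjT)
      also have "\<dots> = a"
        unfolding a_def power2_norm_eq_inner by (metis Qsym QQ)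
      finally show ?thesis by simp
    qed
    also have "\<dots> = inner (P z) (P (blinfun_apply T' w))"
      by (metis Qsym Qw adjT Psym PP)
    also have "\<dots> \<le> norm (P z) * norm (P (blinfun_apply T' w))" by (rule norm_cauchy_schwarz)
    finally have a1: "a \<le> norm (P z) * norm (P (blinfun_apply T' w))" .
    have "norm (blinfun_apply T' w) \<le> q' * norm w" using row'[of w] by (simp add: Qw)
    also have "\<dots> \<le> 1 * norm w" using q' by (intro mult_right_mono) auto
    finally have "(norm (blinfun_apply T' w))\<^sup>2 \<le> (norm w)\<^sup>2" by (simp add: power_mono)
    then have a2: "(norm (P (blinfun_apply T' w)))\<^sup>2 \<le> a"
      using pyth[of "blinfun_apply T' w"] by (simp add: a_def)
    \<comment> \<open>By \<open>a2\<close> and \<open>a1\<close>, the square of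
      \<open>norm (P (T' w))\<close> is at most \<open>a\<close>, and \<open>a\<close> is at most
      its product with \<open>norm (P z)\<close>. Cancelling one factor and inserting the result
      into \<open>a1\<close> gives the bound.\<close>
    have "a \<le> (norm (P z))\<^sup>2"
    proof -
      have "norm (P (blinfun_apply T' w)) * norm (P (blinfun_apply T' w)) \<le> norm (P z) * norm (P (blinfun_apply T' w))"
        using a1 a2 by (simp add: power2_eq_square)
      then have "norm (P (blinfun_apply T' w)) \<le> norm (P z)"
        by (cases "P (blinfun_apply T' w) = 0") (auto dest: mult_right_le_imp_le)
      then have "norm (P z) * norm (P (blinfun_apply T' w)) \<le> norm (P z) * norm (P z)"
        by (intro mult_left_mono) auto
      then show ?thesis using a1 by (simp add: power2_eq_square)
    qed
    then have "(norm ?u)\<^sup>2 \<le> (norm z)\<^sup>2"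
      using total pyth[of z] by (simp add: y_def)
    then show "norm ?u \<le> 1 * norm z" by (metis mult_1 norm_ge_zero power2_le_imp_le)
  qed simp
  then show ?thesis using that clB unfolding J'_def by blast
qed

text \<open>Scaling by \<open>1/r\<close> reduces to \<open>parrott_strict\<close> with
  \<open>q = g/r\<close>. The gap between \<open>g\<close> and \<open>r\<close> makes 1 - DD'
  invertible there; the distance estimates later let \<open>r\<close> decrease to
  \<open>g\<close>.\<close>

lemma parrott:
  fixes J :: "'k::chilbert_space \<Rightarrow>\<^sub>L 'x::chilbert_space"
  assumes J: "clinear_op J" "\<And>x y. inner (blinfun_apply J x) (blinfun_apply J y) = inner x y"
    and T: "clinear_op T"
    and Q: "\<And>x. Q x = x - blinfun_apply J (blinfun_apply (hilbert_adjoint J) x)"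
    and "g < r" "0 < r"
    and row: "\<And>x. norm (Q (blinfun_apply T x)) \<le> g * norm x"
    and col: "\<And>x. norm (blinfun_apply T (Q x)) \<le> g * norm (Q x)"
  obtains B where "clinear_op B" "norm (T - (J o\<^sub>L B o\<^sub>L hilbert_adjoint J)) \<le> r"
proof -
  have Qs: "Q (c *\<^sub>R x) = c *\<^sub>R Q x" for c x
    by (simp add: Q blinfun.bilinear_simps algebra_simps)
  obtain B where B: "clinear_op B" "norm ((1/r) *\<^sub>R T - (J o\<^sub>L B o\<^sub>L hilbert_adjoint J)) \<le> 1"
  proof (rule parrott_strict[OF J clinear_op_scaleR[OF T] Q])
    show "g / r < 1" using assms by simp
    show "norm (Q (blinfun_apply ((1/r) *\<^sub>R T) x)) \<le> g / r * norm x" for x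
      using row[of x] \<open>0 < r\<close> by (simp add: blinfun.bilinear_simps Qs divide_right_mono)
    show "norm (blinfun_apply ((1/r) *\<^sub>R T) (Q x)) \<le> g / r * norm (Q x)" for x
      using col[of x] \<open>0 < r\<close> by (simp add: blinfun.bilinear_simps divide_right_mono)
  qed
  have "T - (J o\<^sub>L (r *\<^sub>R B) o\<^sub>L hilbert_adjoint J) = r *\<^sub>R ((1/r) *\<^sub>R T - (J o\<^sub>L B o\<^sub>L hilbert_adjoint J))"
    using \<open>0 < r\<close> by (intro blinfun_eqI) (simp add: blinfun.bilinear_simps algebra_simps)
  then have "norm (T - (J o\<^sub>L (r *\<^sub>R B) o\<^sub>L hilbert_adjoint J)) \<le> r"
    using B(2) \<open>0 < r\<close> by simp
  then show ?thesis using that[OF clinear_op_scaleR[OF B(1)]] by blast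
qed

section \<open>Hyperreflexivity constants\<close>

lemma bounded_linear_scaleC: "bounded_linear (\<lambda>y. c *\<^sub>C (y::'a::complex_normed_vector))"
  by (rule bounded_linear_intro[where K = "cmod c"])
     (simp_all add: scaleC_add_right scaleC_scaleR norm_scaleC)

lemma complex_subspace_imp_subspace:
  "complex_vector.subspace M \<Longrightarrow> subspace M"
  by (metis complex_vector.subspace_def scaleC_of_real subspace_def)

lemma complex_subspace_closure:
  fixes M :: "'a::complex_normed_vector set"
  assumes "complex_vector.subspace M"
  shows "complex_vector.subspace (closure M)"
proof (rule complex_vector.subspaceI)
  show "0 \<in> closure M"
    using complex_vector.subspace_0[OF assms] closure_subset by blast
  show "x + y \<in> closure M" if "x \<in> closure M" "y \<in> closure M" for x y
  proof -
    obtain f g where "\<And>n. f n \<in> M" "f \<longlonglongrightarrow> x" "\<And>n. g n \<in> M" "g \<longlonglongrightarrow> y"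
      using \<open>x \<in> closure M\<close> \<open>y \<in> closure M\<close> by (meson closure_sequential)
    then have "\<And>n. f n + g n \<in> M" "(\<lambda>n. f n + g n) \<longlonglongrightarrow> x + y"
      using complex_vector.subspace_add[OF assms] by (auto intro: tendsto_add)
    then show ?thesis unfolding closure_sequential by (intro exI[of _ "\<lambda>n. f n + g n"]) blast
  qed
  show "c *\<^sub>C x \<in> closure M" if "x \<in> closure M" for c x
  proof -
    have "(\<lambda>y. c *\<^sub>C y) ` closure M \<subseteq> closure ((\<lambda>y. c *\<^sub>C y) ` M)"
      by (rule closure_bounded_linear_image_subset[OF bounded_linear_scaleC])
    also have "\<dots> \<subseteq> closure M"
      using complex_vector.subspace_scale[OF assms] by (intro closure_mono) auto
    finally show ?thesis using that by blast
  qed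
qed

text \<open>This justifies the description operator in \<open>orth_proj\<close>: existence comes
  from the Riesz lemma, and the difference of two candidates is orthogonal to itself. Real
  orthogonality to a complex subspace upgrades to complex orthogonality.\<close>

lemma orth_proj:
  fixes M :: "'a::chilbert_space set"
  assumes "closed M" "complex_vector.subspace M"
  shows "orth_proj M v \<in> M" "m \<in> M \<Longrightarrow> cinner (v - orth_proj M v) m = 0"
proof -
  obtain p where p: "p \<in> M" "\<And>m. m \<in> M \<Longrightarrow> inner p m = inner v m"
    using riesz_on_closed_subspace[OF assms(1) complex_subspace_imp_subspace[OF assms(2)] bounded_linear_inner_right]
    by metis
  have p2: "cinner (v - p) m = 0" if "m \<in> M" for m
    by (rule cinner_eq_zero_iff_inner[of _ M])
       (auto simp: p(2) inner_diff_left complex_vector.subspace_scale[OF assms(2) that])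
  have "orth_proj M v \<in> M \<and> (\<forall>m\<in>M. cinner (v - orth_proj M v) m = 0)"
    unfolding orth_proj_def
  proof (rule theI)
    show "p \<in> M \<and> (\<forall>m\<in>M. cinner (v - p) m = 0)" using p(1) p2 by blast
    fix p' assume p': "p' \<in> M \<and> (\<forall>m\<in>M. cinner (v - p') m = 0)"
    have "p - p' \<in> M" using p(1) p' complex_vector.subspace_diff[OF assms(2)] by blast
    then have "cinner (v - p') (p - p') - cinner (v - p) (p - p') = 0"
      using p' p2 by simp
    then have "cinner (p - p') (p - p') = 0"
      by (simp add: cinner_diff_left)
    then show "p' = p" by (simp add: cinner_self)
  qed
  then show "orth_proj M v \<in> M" "m \<in> M \<Longrightarrow> cinner (v - orth_proj M v) m = 0" by blast+
qed

lemma norm_diff_orth_proj_le: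
  fixes M :: "'a::chilbert_space set"
  assumes "closed M" "complex_vector.subspace M" "m \<in> M"
  shows "norm (v - orth_proj M v) \<le> norm (v - m)"
proof -
  define p where "p = orth_proj M v"
  have "p - m \<in> M" unfolding p_def
    using orth_proj(1)[OF assms(1,2)] assms complex_vector.subspace_diff by blast
  then have "inner (v - p) (p - m) = 0"
    using orth_proj(2)[OF assms(1,2), of "p - m" v] unfolding p_def Re_cinner[symmetric] by simp
  then have "(norm (v - m))\<^sup>2 = (norm (v - p))\<^sup>2 + (norm (p - m))\<^sup>2"
    by (simp add: power2_norm_eq_inner inner_simps inner_commute)
  then show ?thesis unfolding p_def by (simp add: power2_le_imp_le)
qed

section \<open>Estimates of \<open>hr_beta\<close> by distances to single orbit vectors\<close>

context
  fixes S :: "('a::chilbert_space \<Rightarrow>\<^sub>L 'a) set"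
  assumes S: "complex_vector.subspace S"
begin

lemma orbit_subspace: "complex_vector.subspace (closure ((\<lambda>A. blinfun_apply A x) ` S))"
proof (intro complex_subspace_closure complex_vector.subspaceI)
  show "0 \<in> (\<lambda>A. blinfun_apply A x) ` S"
    using complex_vector.subspace_0[OF S] by (metis blinfun.zero_left image_eqI)
  show "u + v \<in> (\<lambda>A. blinfun_apply A x) ` S"
    if "u \<in> (\<lambda>A. blinfun_apply A x) ` S" "v \<in> (\<lambda>A. blinfun_apply A x) ` S" for u v
    using that complex_vector.subspace_add[OF S] by (auto simp flip: blinfun.add_left)
  show "c *\<^sub>C u \<in> (\<lambda>A. blinfun_apply A x) ` S" if "u \<in> (\<lambda>A. blinfun_apply A x) ` S" for c u
  proof -
    from that obtain A where A: "A \<in> S" "u = blinfun_apply A x" by blast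
    then show ?thesis
      using complex_vector.subspace_scale[OF S, of A c]
      by (intro image_eqI[of _ _ "c *\<^sub>C A"]) (simp_all add: scaleC_blinfun.rep_eq)
  qed
qed

lemma residual_le:
  assumes "A \<in> S"
  shows "norm (v - orth_proj (closure ((\<lambda>A. blinfun_apply A x) ` S)) v) \<le> norm (v - blinfun_apply A x)"
  using assms closure_subset by (intro norm_diff_orth_proj_le orbit_subspace) (auto intro!: subsetD[OF closure_subset])

lemma bdd_above_residuals:
  "bdd_above ((\<lambda>x. norm (blinfun_apply T x
     - orth_proj (closure ((\<lambda>A. blinfun_apply A x) ` S)) (blinfun_apply T x))) ` {x. norm x = 1})"
proof (rule bdd_aboveI2)
  fix x :: 'a assume "x \<in> {x. norm x = 1}"
  then show "norm (blinfun_apply T x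
     - orth_proj (closure ((\<lambda>A. blinfun_apply A x) ` S)) (blinfun_apply T x)) \<le> norm T"
    using residual_le[OF complex_vector.subspace_0[OF S], of "blinfun_apply T x" x] norm_blinfun[of T x]
    by simp
qed

text \<open>Keeping distance at least \<open>c\<close> from Tx is a closed condition, so it passes
  from the orbit to its closure and hence to the projection. Homogeneity in \<open>x\<close> allows
  test vectors that are not normalized.\<close>

lemma hr_beta_ge:
  assumes "\<And>A. A \<in> S \<Longrightarrow> c \<le> norm (blinfun_apply T x - blinfun_apply A x)"
  shows "c \<le> hr_beta S T * norm x"
proof (cases "x = 0")
  case True
  then show ?thesis using assms[OF complex_vector.subspace_0[OF S]] by simp
next
  case False
  define y where "y = (1 / norm x) *\<^sub>R x"
  have y: "norm y = 1" using False by (simp add: y_def)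
  let ?M = "closure ((\<lambda>A. blinfun_apply A y) ` S)"
  have "?M \<subseteq> {m. c / norm x \<le> norm (blinfun_apply T y - m)}"
  proof (rule closure_minimal)
    show "(\<lambda>A. blinfun_apply A y) ` S \<subseteq> {m. c / norm x \<le> norm (blinfun_apply T y - m)}"
      using assms False
      by (auto simp: y_def blinfun.scaleR_right divide_right_mono simp flip: scaleR_diff_right)
    show "closed {m. c / norm x \<le> norm (blinfun_apply T y - m)}"
      by (intro closed_Collect_le continuous_intros)
  qed
  moreover have "orth_proj ?M (blinfun_apply T y) \<in> ?M"
    by (rule orth_proj(1)[OF closed_closure orbit_subspace])
  ultimately have "c / norm x \<le> norm (blinfun_apply T y - orth_proj ?M (blinfun_apply T y))"
    by blast
  also have "\<dots> \<le> hr_beta S T"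
    unfolding hr_beta_def by (rule cSUP_upper[OF _ bdd_above_residuals]) (simp add: y)
  finally show ?thesis using False by (simp add: field_simps)
qed

text \<open>The orthogonal projection is at least as close to Tx as any Ax. The unit vector
  \<open>x0\<close> makes the supremum range over a nonempty set.\<close>

lemma hr_beta_le:
  assumes "\<And>x. norm x = 1 \<Longrightarrow> \<exists>A\<in>S. norm (blinfun_apply T x - blinfun_apply A x) \<le> c"
    and "norm (x0 :: 'a) = 1"
  shows "hr_beta S T \<le> c"
  unfolding hr_beta_def
proof (rule cSUP_least)
  show "{x::'a. norm x = 1} \<noteq> {}" using assms(2) by blast
  fix x :: 'a assume "x \<in> {x. norm x = 1}"
  then obtain A where "A \<in> S" "norm (blinfun_apply T x - blinfun_apply A x) \<le> c"
    using assms(1) by blast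
  then show "norm (blinfun_apply T x
     - orth_proj (closure ((\<lambda>A. blinfun_apply A x) ` S)) (blinfun_apply T x)) \<le> c"
    using residual_le order_trans by blast
qed

end

lemma hr_const_le:
  assumes "0 \<le> C" "\<And>T. clinear_op T \<Longrightarrow> infdist T S \<le> C * hr_beta S T"
  shows "hr_const S \<le> ereal C"
  unfolding hr_const_def using assms by (intro INF_lower) (simp add: bounded_ops_iff)

text \<open>One test operator forces every admissible \<open>C\<close> to satisfy r <= dist(T, S) <=
  C. Nonemptiness of \<open>S\<close> matters because \<open>infdist\<close> to the empty set is
  0.\<close>

lemma hr_const_ge:
  assumes "clinear_op T" "S \<noteq> {}" "\<And>A. A \<in> S \<Longrightarrow> r \<le> norm (T - A)" "hr_beta S T \<le> 1"
  shows "ereal r \<le> hr_const S"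
  unfolding hr_const_def
proof (rule INF_greatest)
  fix C assume "C \<in> {C::real. 0 \<le> C \<and> (\<forall>T\<in>bounded_ops. infdist T S \<le> C * hr_beta S T)}"
  then have C: "0 \<le> C" "infdist T S \<le> C * hr_beta S T"
    using assms(1) by (auto simp: bounded_ops_iff)
  have "r \<le> infdist T S"
    unfolding infdist_def using assms(2,3) by (auto simp: dist_norm intro: cINF_greatest)
  also have "\<dots> \<le> C" using C(2) mult_left_mono[OF assms(4) C(1)] by simp
  finally show "ereal r \<le> ereal C" by simp
qed

section \<open>The amplified one-dimensional space\<close>

definition rank_one :: "'b::complex_normed_vector \<Rightarrow> 'a::complex_inner \<Rightarrow> 'a \<Rightarrow>\<^sub>L 'b" where
  "rank_one b a = Blinfun (\<lambda>x. cinner x a *\<^sub>C b)"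

lemma rank_one_apply: "blinfun_apply (rank_one b a) x = cinner x a *\<^sub>C b"
proof -
  have "bounded_linear (\<lambda>x. cinner x a *\<^sub>C b)"
  proof (rule bounded_linear_intro[where K = "norm a * norm b"])
    show "norm (cinner x a *\<^sub>C b) \<le> norm x * (norm a * norm b)" for x
      using mult_right_mono[OF norm_cinner_le[of x a], of "norm b"]
      by (simp add: norm_scaleC mult.assoc)
    show "cinner (r *\<^sub>R x) a *\<^sub>C b = r *\<^sub>R cinner x a *\<^sub>C b" for r x
      by (metis cinner_scaleR_left scaleC_of_real scaleC_scaleC)
  qed (simp add: cinner_add_left scaleC_add_left)
  then show ?thesis by (simp add: rank_one_def bounded_linear_Blinfun_apply)
qed

lemma clinear_op_rank_one: "clinear_op (rank_one b a)"
  by (simp add: clinear_op_def rank_one_apply cinner_scaleC_left scaleC_scaleC)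

text \<open>\<open>J0\<close> and \<open>J1\<close> stand for the embeddings of K as the summands of
  the tensor product belonging to the first two basis vectors; their adjoints \<open>c0\<close> and
  \<open>c1\<close> read off the coordinates. The vectors \<open>u\<close> and \<open>v\<close>
  serve to build test operators.\<close>

locale two_isometries =
  fixes J0 J1 :: "'k::chilbert_space \<Rightarrow>\<^sub>L 'x::chilbert_space" and u v :: 'k
  assumes clinear_J: "clinear_op J0" "clinear_op J1"
    and isometry_J: "inner (blinfun_apply J0 x) (blinfun_apply J0 y) = inner x y"
      "inner (blinfun_apply J1 x) (blinfun_apply J1 y) = inner x y"
    and orthogonal_J: "inner (blinfun_apply J0 x) (blinfun_apply J1 y) = 0"
    and orthonormal_uv: "norm u = 1" "norm v = 1" "cinner u v = 0"
begin

definition c0 where "c0 = hilbert_adjoint J0"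
definition c1 where "c1 = hilbert_adjoint J1"

definition Q where "Q x = x - blinfun_apply J0 (blinfun_apply c0 x)"

text \<open>This is the tensor product of T_s with \<open>B\<close>, written in coordinates;
  \<open>wot_tensor_diag_T\<close> makes the identification.\<close>

definition amp :: "real \<Rightarrow> ('k \<Rightarrow>\<^sub>L 'k) \<Rightarrow> 'x \<Rightarrow>\<^sub>L 'x" where
  "amp s B = (J0 o\<^sub>L B o\<^sub>L c0) + s *\<^sub>R (J1 o\<^sub>L B o\<^sub>L c1)"

definition amps :: "real \<Rightarrow> ('x \<Rightarrow>\<^sub>L 'x) set" where
  "amps s = amp s ` {B. clinear_op B}"

lemma clinear_c: "clinear_op c0" "clinear_op c1"
  unfolding c0_def c1_def by (intro clinear_op_hilbert_adjoint clinear_J)+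

lemma inner_J: "inner (blinfun_apply J0 x) y = inner x (blinfun_apply c0 y)"
  "inner (blinfun_apply J1 x) y = inner x (blinfun_apply c1 y)"
  unfolding c0_def c1_def by (rule inner_hilbert_adjoint)+

lemma cinner_J: "cinner (blinfun_apply J0 x) y = cinner x (blinfun_apply c0 y)"
  "cinner (blinfun_apply J1 x) y = cinner x (blinfun_apply c1 y)"
  unfolding c0_def c1_def by (intro cinner_hilbert_adjoint clinear_J)+

lemma cinner_J': "cinner y (blinfun_apply J0 x) = cinner (blinfun_apply c0 y) x"
  "cinner y (blinfun_apply J1 x) = cinner (blinfun_apply c1 y) x"
  using cinner_J cinner_commute by metis+

lemma norm_J [simp]: "norm (blinfun_apply J0 x) = norm x" "norm (blinfun_apply J1 x) = norm x"
  by (simp_all add: norm_eq_sqrt_inner isometry_J)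

lemma c_J [simp]: "blinfun_apply c0 (blinfun_apply J0 x) = x" "blinfun_apply c1 (blinfun_apply J1 x) = x"
  "blinfun_apply c0 (blinfun_apply J1 x) = 0" "blinfun_apply c1 (blinfun_apply J0 x) = 0"
proof -
  show "blinfun_apply c0 (blinfun_apply J0 x) = x" "blinfun_apply c1 (blinfun_apply J1 x) = x"
    by (rule vector_eq_ldot[THEN iffD1], simp add: inner_J[symmetric] isometry_J)+
  show "blinfun_apply c0 (blinfun_apply J1 x) = 0" "blinfun_apply c1 (blinfun_apply J0 x) = 0"
    by (rule vector_eq_ldot[THEN iffD1], simp add: inner_J[symmetric] orthogonal_J inner_commute)+
qed

lemma amp_apply: "blinfun_apply (amp s B) x =
    blinfun_apply J0 (blinfun_apply B (blinfun_apply c0 x)) + s *\<^sub>R blinfun_apply J1 (blinfun_apply B (blinfun_apply c1 x))"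
  by (simp add: amp_def blinfun.bilinear_simps)

lemma clinear_amp: "clinear_op B \<Longrightarrow> clinear_op (amp s B)"
  unfolding amp_def by (intro clinear_op_intros clinear_J clinear_c)

lemma amp_linear: "amp s (A + B) = amp s A + amp s B" "amp s (A - B) = amp s A - amp s B"
  "amp s (c *\<^sub>C A) = c *\<^sub>C amp s A"
  by (auto intro!: blinfun_eqI simp: amp_apply blinfun.bilinear_simps scaleC_blinfun.rep_eq
      clinear_opD clinear_J scaleC_add_right scaleC_scaleR algebra_simps)

lemma amp_in_amps: "clinear_op B \<Longrightarrow> amp s B \<in> amps s"
  by (simp add: amps_def)

lemma subspace_amps: "complex_vector.subspace (amps s)"
proof (rule complex_vector.subspaceI)
  have "amp s 0 = 0" using amp_linear(2)[of s 0 0] by simp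
  then show "0 \<in> amps s" using amp_in_amps[OF clinear_op_zero] by metis
  show "x + y \<in> amps s" if "x \<in> amps s" "y \<in> amps s" for x y
    using that unfolding amps_def by (auto simp: clinear_op_add simp flip: amp_linear)
  show "c *\<^sub>C x \<in> amps s" if "x \<in> amps s" for c x
    using that unfolding amps_def by (auto simp: clinear_op_scaleC simp flip: amp_linear)
qed

lemma Q_linear: "Q (x + y) = Q x + Q y" "Q (x - y) = Q x - Q y" "Q (r *\<^sub>R x) = r *\<^sub>R Q x"
  by (simp_all add: Q_def blinfun.bilinear_simps algebra_simps)

lemma Q_J [simp]: "Q (blinfun_apply J0 x) = 0" "Q (blinfun_apply J1 x) = blinfun_apply J1 x"
  by (simp_all add: Q_def)

lemma c0_Q [simp]: "blinfun_apply c0 (Q x) = 0"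
  by (simp add: Q_def blinfun.bilinear_simps)

lemma J0_c0_plus_Q: "blinfun_apply J0 (blinfun_apply c0 x) + Q x = x"
  by (simp add: Q_def)

lemma pythagoras: "(norm x)\<^sup>2 = (norm (blinfun_apply c0 x))\<^sup>2 + (norm (Q x))\<^sup>2"
proof -
  have "inner (blinfun_apply J0 (blinfun_apply c0 x)) (Q x) = 0"
    by (simp add: inner_J)
  then show ?thesis
    using norm_add_Pythagorean[of "blinfun_apply J0 (blinfun_apply c0 x)" "Q x"]
    by (simp add: J0_c0_plus_Q orthogonal_def)
qed

lemma norm_c0_le: "norm (blinfun_apply c0 x) \<le> norm x"
  using pythagoras[of x] by (simp add: power2_le_imp_le)

lemma norm_Q_le: "norm (Q x) \<le> norm x"
  using pythagoras[of x] by (simp add: power2_le_imp_le)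

text \<open>Source of the factor \<open>sqrt 2\<close> in the row estimate: the two coordinates of
  \<open>x\<close> are orthogonal, and a + b <= sqrt(2 (a^2 + b^2)).\<close>

lemma norm_sum_le: "norm (blinfun_apply c0 x) + norm (Q x) \<le> sqrt 2 * norm x"
proof (rule power2_le_imp_le)
  have "0 \<le> (norm (blinfun_apply c0 x) - norm (Q x))\<^sup>2" by simp
  then show "(norm (blinfun_apply c0 x) + norm (Q x))\<^sup>2 \<le> (sqrt 2 * norm x)\<^sup>2"
    unfolding power_mult_distrib pythagoras[of x] by (simp add: power2_sum power2_diff)
qed simp

lemma bessel: "(norm (blinfun_apply c0 x))\<^sup>2 + (norm (blinfun_apply c1 x))\<^sup>2 \<le> (norm x)\<^sup>2"
proof -
  define y where "y = Q x"
  have c1: "blinfun_apply c1 x = blinfun_apply c1 y"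
    by (simp add: y_def Q_def blinfun.bilinear_simps)
  have "(norm (blinfun_apply c1 y))\<^sup>2 = inner (blinfun_apply J1 (blinfun_apply c1 y)) y"
    by (simp add: inner_J power2_norm_eq_inner)
  also have "\<dots> \<le> norm (blinfun_apply c1 y) * norm y"
    using norm_cauchy_schwarz[of "blinfun_apply J1 (blinfun_apply c1 y)" y] by simp
  finally have "norm (blinfun_apply c1 y) \<le> norm y"
    by (cases "blinfun_apply c1 y = 0") (auto simp: power2_eq_square dest: mult_left_le_imp_le)
  then show ?thesis unfolding pythagoras[of x] c1 y_def[symmetric] by (simp add: power_mono)
qed

lemma norm_c1_le: "norm (blinfun_apply c1 x) \<le> norm x"
proof (rule power2_le_imp_le)
  show "(norm (blinfun_apply c1 x))\<^sup>2 \<le> (norm x)\<^sup>2"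
    using bessel[of x] zero_le_power2[of "norm (blinfun_apply c0 x)"] by linarith
qed simp

lemma amps_parrott:
  assumes "clinear_op T" "g < r" "0 < r"
    and "\<And>x. norm (Q (blinfun_apply T x)) \<le> g * norm x"
    and "\<And>x. norm (blinfun_apply T (Q x)) \<le> g * norm (Q x)"
  obtains B where "clinear_op B" "norm (T - (J0 o\<^sub>L B o\<^sub>L c0)) \<le> r"
  using parrott[OF clinear_J(1) isometry_J(1) assms(1) Q_def[unfolded c0_def] assms(2-5)]
  unfolding c0_def by blast

lemma hr_beta_amps_nonneg: "0 \<le> hr_beta (amps s) T"
  using hr_beta_ge[OF subspace_amps, of s 0 T "blinfun_apply J0 u"] by (simp add: orthonormal_uv)

text \<open>For s = 0 the space acts only in the corner: its elements map into the range of
  \<open>J0\<close> and vanish on the range of \<open>Q\<close>. So \<open>beta\<close> bounds QT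
  and TQ directly, and Parrott's theorem applies without loss.\<close>

lemma hr_const_amps_0_le: "hr_const (amps 0) \<le> 1"
proof -
  have "infdist T (amps 0) \<le> 1 * hr_beta (amps 0) T" if T: "clinear_op T" for T
  proof -
    define \<beta> where "\<beta> = hr_beta (amps 0) T"
    have ge: "c \<le> \<beta> * norm x"
      if "\<And>A. A \<in> amps 0 \<Longrightarrow> c \<le> norm (blinfun_apply T x - blinfun_apply A x)" for c x
      unfolding \<beta>_def by (rule hr_beta_ge[OF subspace_amps that])
    have row: "norm (Q (blinfun_apply T x)) \<le> \<beta> * norm x" for x
    proof (rule ge)
      fix A assume "A \<in> amps 0"
      then have "Q (blinfun_apply A x) = 0" by (auto simp: amps_def amp_apply)
      then show "norm (Q (blinfun_apply T x)) \<le> norm (blinfun_apply T x - blinfun_apply A x)"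
        using norm_Q_le[of "blinfun_apply T x - blinfun_apply A x"] by (simp add: Q_linear)
    qed
    have col: "norm (blinfun_apply T (Q x)) \<le> \<beta> * norm (Q x)" for x
    proof (rule ge)
      fix A assume "A \<in> amps 0"
      then have "blinfun_apply A (Q x) = 0" by (auto simp: amps_def amp_apply)
      then show "norm (blinfun_apply T (Q x)) \<le> norm (blinfun_apply T (Q x) - blinfun_apply A (Q x))"
        by simp
    qed
    have "infdist T (amps 0) \<le> max \<beta> 0"
    \<comment> \<open>Parrott's theorem is available for each \<open>r\<close> strictly above
      \<open>beta\<close>; density of the reals gives the endpoint.\<close>
    proof (rule dense_ge)
      fix r assume r: "max \<beta> 0 < r"
      then obtain B where B: "clinear_op B" "norm (T - (J0 o\<^sub>L B o\<^sub>L c0)) \<le> r"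
        using amps_parrott[OF T _ _ row col, of r] by auto
      have "infdist T (amps 0) \<le> dist T (amp 0 B)" by (rule infdist_le[OF amp_in_amps[OF B(1)]])
      also have "\<dots> \<le> r" using B(2) by (simp add: amp_def dist_norm)
      finally show "infdist T (amps 0) \<le> r" .
    qed
    then show ?thesis using hr_beta_amps_nonneg unfolding \<beta>_def by (simp add: max_absorb1)
  qed
  then show ?thesis using hr_const_le[of 1 "amps 0"] by (simp add: one_ereal_def)
qed

lemma hr_const_amps_0_ge: "1 \<le> hr_const (amps 0)"
proof -
  \<comment> \<open>The projection onto the line of \<open>J1 u\<close>, a vector that every element
    of \<open>amps 0\<close> annihilates.\<close>
  define T where "T = rank_one (blinfun_apply J1 u) (blinfun_apply J1 u)"
  have "ereal 1 \<le> hr_const (amps 0)"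
  proof (rule hr_const_ge)
    show "clinear_op T" unfolding T_def by (rule clinear_op_rank_one)
    show "amps 0 \<noteq> {}" using complex_vector.subspace_0[OF subspace_amps] by blast
    show "1 \<le> norm (T - A)" if "A \<in> amps 0" for A
    proof -
      have "blinfun_apply (T - A) (blinfun_apply J1 u) = blinfun_apply J1 u"
        using that by (auto simp: T_def rank_one_apply amps_def amp_apply blinfun.bilinear_simps
            cinner_self orthonormal_uv)
      then show ?thesis
        using norm_blinfun[of "T - A" "blinfun_apply J1 u"] by (simp add: orthonormal_uv)
    qed
    show "hr_beta (amps 0) T \<le> 1"
    proof (rule hr_beta_le[OF subspace_amps])
      show "\<exists>A\<in>amps 0. norm (blinfun_apply T x - blinfun_apply A x) \<le> 1" if "norm x = 1" for x
        using complex_vector.subspace_0[OF subspace_amps] norm_cinner_le[of x "blinfun_apply J1 u"] that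
        by (intro bexI[of _ 0]) (simp_all add: T_def rank_one_apply norm_scaleC orthonormal_uv)
      show "norm (blinfun_apply J1 u) = 1" by (simp add: orthonormal_uv)
    qed
  qed
  then show ?thesis by (simp add: one_ereal_def)
qed

text \<open>The test operator has norm \<open>sqrt 2\<close>, attained at \<open>\<eta>\<close>.
  Reducing this norm by an element of the space requires \<open>B v\<close> of size about 1/s, but
  \<open>B v\<close> is visible at \<open>J0 v\<close>, which \<open>T\<close> annihilates.\<close>

lemma hr_const_amps_ge:
  assumes s: "0 < s"
  shows "ereal (2 / (sqrt 2 + s)) \<le> hr_const (amps s)"
proof -
  define \<eta> where "\<eta> = blinfun_apply J0 u + blinfun_apply J1 v"
  define T where "T = rank_one (blinfun_apply J1 u) \<eta>"
  have vu: "cinner v u = 0" using orthonormal_uv(3) by (metis cinner_commute complex_cnj_zero)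
  have T: "blinfun_apply T x = (cinner (blinfun_apply c0 x) u + cinner (blinfun_apply c1 x) v) *\<^sub>C blinfun_apply J1 u" for x
    by (simp add: T_def rank_one_apply \<eta>_def cinner_add_right cinner_J')
  have zero: "0 \<in> amps s" by (rule complex_vector.subspace_0[OF subspace_amps])
  show ?thesis
  proof (rule hr_const_ge)
    show "clinear_op T" unfolding T_def by (rule clinear_op_rank_one)
    show "amps s \<noteq> {}" using zero by blast
    show "2 / (sqrt 2 + s) \<le> norm (T - A)" if A: "A \<in> amps s" for A
    proof -
      define N where "N = norm (T - A)"
      obtain B where B: "A = amp s B" using A by (auto simp: amps_def)
      have "blinfun_apply (T - A) (blinfun_apply J0 v) = - blinfun_apply J0 (blinfun_apply B v)"
        by (simp add: B T amp_apply blinfun.bilinear_simps vu)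
      then have Bv: "norm (blinfun_apply B v) \<le> N"
        using norm_blinfun[of "T - A" "blinfun_apply J0 v"] by (simp add: orthonormal_uv N_def)
      \<comment> \<open>At \<open>\<eta>\<close> the operator \<open>T\<close> gives twice
        \<open>J1 u\<close>, and the space can change this second coordinate only by
        \<open>s\<close> times \<open>B v\<close>.\<close>
      have "blinfun_apply c1 (blinfun_apply (T - A) \<eta>) = 2 *\<^sub>R u - s *\<^sub>R blinfun_apply B v"
        using scaleC_of_real[of 2 u]
        by (simp add: B T amp_apply blinfun.bilinear_simps \<eta>_def cinner_self orthonormal_uv clinear_opD clinear_c scaleR_2)
      then have "norm (2 *\<^sub>R u - s *\<^sub>R blinfun_apply B v) \<le> norm (blinfun_apply (T - A) \<eta>)"
        using norm_c1_le by metis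
      also have "\<dots> \<le> N * norm \<eta>" unfolding N_def by (rule norm_blinfun)
      also have "norm \<eta> = sqrt 2"
        using norm_add_Pythagorean[of "blinfun_apply J0 u" "blinfun_apply J1 v"]
        by (simp add: \<eta>_def orthogonal_def orthogonal_J orthonormal_uv real_sqrt_unique)
      finally have "norm (2 *\<^sub>R u - s *\<^sub>R blinfun_apply B v) \<le> N * sqrt 2" .
      moreover have "norm (2 *\<^sub>R u) \<le> norm (2 *\<^sub>R u - s *\<^sub>R blinfun_apply B v) + norm (s *\<^sub>R blinfun_apply B v)"
        by (metis norm_triangle_sub add.commute)
      ultimately have "2 \<le> N * sqrt 2 + s * norm (blinfun_apply B v)"
        using s by (simp add: orthonormal_uv)
      also have "\<dots> \<le> N * sqrt 2 + s * N" using s Bv by simp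
      finally show ?thesis using s unfolding N_def[symmetric]
        by (subst pos_divide_le_eq) (auto simp: algebra_simps intro: add_nonneg_pos)
    qed
    show "hr_beta (amps s) T \<le> 1"
    proof (rule hr_beta_le[OF subspace_amps])
      show "norm (blinfun_apply J1 u) = 1" by (simp add: orthonormal_uv)
      fix x :: 'x assume x: "norm x = 1"
      define x0 where "x0 = blinfun_apply c0 x"
      define x1 where "x1 = blinfun_apply c1 x"
      \<comment> \<open>\<open>l\<close> is the coefficient of the projection of \<open>x1\<close>
        onto \<open>x0\<close>. If \<open>x0 = 0\<close>, division by zero makes
        \<open>l = 0\<close>, hence \<open>z = x1\<close>.\<close>
      define l where "l = cinner x1 x0 / cinner x0 x0"
      define z where "z = x1 - l *\<^sub>C x0"
      have z0: "cinner x0 z = 0"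
      proof -
        have "cinner z x0 = 0"
          by (cases "x0 = 0") (simp_all add: z_def cinner_diff_left cinner_scaleC_left l_def cinner_self)
        then show ?thesis by (metis cinner_commute complex_cnj_zero)
      qed
      show "\<exists>A\<in>amps s. norm (blinfun_apply T x - blinfun_apply A x) \<le> 1"
      proof (cases "z = 0")
        case True
        \<comment> \<open>When \<open>x1\<close> is a multiple of \<open>x0\<close>, the zero
          operator suffices: orthogonality of \<open>u\<close> and \<open>v\<close> turns
          Cauchy-Schwarz into the bound by the sum of the squared norms of \<open>x0\<close> and
          \<open>x1\<close>, which Bessel's inequality bounds by 1.\<close>
        then have x1: "x1 = l *\<^sub>C x0" by (simp add: z_def)
        have uv: "(norm (u + cnj l *\<^sub>C v))\<^sup>2 = 1 + (cmod l)\<^sup>2"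
        proof -
          have "inner u (cnj l *\<^sub>C v) = 0"
            by (simp add: Re_cinner[symmetric] cinner_scaleC_right orthonormal_uv)
          then show ?thesis
            using norm_add_Pythagorean[of u "cnj l *\<^sub>C v"]
            by (simp add: orthogonal_def norm_scaleC orthonormal_uv)
        qed
        have "norm (blinfun_apply T x) = norm (cinner x0 (u + cnj l *\<^sub>C v))"
          unfolding T x0_def[symmetric] x1_def[symmetric]
          by (simp add: x1 cinner_add_right cinner_scaleC_right cinner_scaleC_left norm_scaleC orthonormal_uv)
        also have "\<dots> \<le> norm x0 * norm (u + cnj l *\<^sub>C v)" by (rule norm_cinner_le)
        finally have "(norm (blinfun_apply T x))\<^sup>2 \<le> (norm x0)\<^sup>2 * (1 + (cmod l)\<^sup>2)"
          using power_mono[of _ _ 2] by (fastforce simp: power_mult_distrib uv)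
        also have "\<dots> = (norm x0)\<^sup>2 + (norm x1)\<^sup>2"
          by (simp add: x1 norm_scaleC power_mult_distrib algebra_simps)
        also have "\<dots> \<le> 1" using bessel[of x] x by (simp add: x0_def x1_def)
        finally have "norm (blinfun_apply T x) \<le> 1" by (simp add: power2_le_imp_le abs_square_le_1)
        then show ?thesis using zero by (intro bexI[of _ 0]) simp_all
      next
        case False
        define c where "c = cinner x0 u + cinner x1 v"
        \<comment> \<open>\<open>B\<close> annihilates \<open>x0\<close> and sends \<open>x1\<close>
          to \<open>c/s\<close> times \<open>u\<close>, so its amplification agrees with
          \<open>T\<close> at \<open>x\<close>. Positivity of \<open>s\<close> enters here.\<close>
        define B where "B = rank_one ((c / (of_real s * cinner z z)) *\<^sub>C u) z"
        have zz: "cinner x1 z = cinner z z"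
          by (simp add: z_def[THEN eq_diff_eq[THEN iffD1], symmetric] cinner_add_left cinner_scaleC_left z0)
        have Bx: "blinfun_apply B x0 = 0" "s *\<^sub>R blinfun_apply B x1 = c *\<^sub>C u"
          using False s by (simp_all add: B_def rank_one_apply z0 zz cinner_self scaleC_scaleC flip: scaleC_of_real)
        have "blinfun_apply (amp s B) x = blinfun_apply T x"
          unfolding amp_apply T x0_def[symmetric] x1_def[symmetric] c_def[symmetric]
          by (simp add: Bx blinfun.scaleR_right[of _ s "blinfun_apply B x1", symmetric] clinear_opD[OF clinear_J(2)])
        then show ?thesis
          using amp_in_amps[of B s] clinear_op_rank_one unfolding B_def by (metis diff_self norm_zero zero_le_one)
      qed
    qed
  qed
qed

text \<open>With \<open>\<sigma>\<close> the square root of \<open>s\<close>, the factor 1 + 4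
  \<open>\<sigma>\<close> + s is (1 + \<open>\<sigma>\<close>)^2 + 2 \<open>\<sigma>\<close>, the
  loss in bounding QTQ. Combining two blocks costs \<open>sqrt 2\<close>, and restoring the second
  diagonal entry costs 1 + s.\<close>

lemma infdist_amps_le:
  assumes T: "clinear_op T" and s: "0 < s"
  shows "infdist T (amps s) \<le> (1 + s) * (sqrt 2 * (1 + 4 * sqrt s + s)) * hr_beta (amps s) T"
proof -
  define \<beta> where "\<beta> = hr_beta (amps s) T"
  \<comment> \<open>This size balances two perturbations: the test vector is tilted by
    \<open>\<sigma>\<close>, and the functional annihilating its orbit by s/\<open>\<sigma>\<close>
    = \<open>\<sigma>\<close>.\<close>
  define \<sigma> where "\<sigma> = sqrt s"
  have \<sigma>: "0 < \<sigma>" "\<sigma> * \<sigma> = s" using s by (simp_all add: \<sigma>_def)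
  have \<beta>: "0 \<le> \<beta>" unfolding \<beta>_def by (rule hr_beta_amps_nonneg)
  define \<eta> where "\<eta> = 1 + 4 * \<sigma> + s"
  have \<eta>: "1 \<le> \<eta>" using s \<sigma> by (simp add: \<eta>_def)
  \<comment> \<open>Subtracting the amplification of \<open>B0\<close> clears the corner of
    \<open>T\<close> and leaves all distances to orbits unchanged.\<close>
  define B0 where "B0 = c0 o\<^sub>L T o\<^sub>L J0"
  have B0: "clinear_op B0" unfolding B0_def by (intro clinear_op_intros clinear_J clinear_c T)
  define T' where "T' = T - amp s B0"
  have T': "clinear_op T'" unfolding T'_def by (intro clinear_op_intros T clinear_amp B0)
  have T'00: "blinfun_apply c0 (blinfun_apply T' (blinfun_apply J0 x)) = 0" for x
    by (simp add: T'_def blinfun.bilinear_simps amp_apply B0_def)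
  have ge: "c \<le> \<beta> * norm x"
    if "\<And>B. c \<le> norm (blinfun_apply T' x - blinfun_apply (amp s B) x)" for c x
    unfolding \<beta>_def
  proof (rule hr_beta_ge[OF subspace_amps])
    fix A assume "A \<in> amps s"
    then obtain B where "A = amp s B" by (auto simp: amps_def)
    then have "blinfun_apply T x - blinfun_apply A x = blinfun_apply T' x - blinfun_apply (amp s (B - B0)) x"
      by (simp add: T'_def amp_linear blinfun.bilinear_simps)
    then show "c \<le> norm (blinfun_apply T x - blinfun_apply A x)" using that by simp
  qed
  \<comment> \<open>The space maps the range of \<open>J0\<close> into itself, so it cannot affect
    this block; in \<open>cQ\<close> it likewise preserves the kernel of \<open>c0\<close>.\<close>
  have QJ: "norm (Q (blinfun_apply T' (blinfun_apply J0 x))) \<le> \<beta> * norm x" for x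
  proof -
    have "norm (Q (blinfun_apply T' (blinfun_apply J0 x))) \<le> \<beta> * norm (blinfun_apply J0 x)"
    proof (rule ge)
      fix B
      let ?d = "blinfun_apply T' (blinfun_apply J0 x) - blinfun_apply (amp s B) (blinfun_apply J0 x)"
      have "Q ?d = Q (blinfun_apply T' (blinfun_apply J0 x))"
        by (simp add: Q_linear amp_apply)
      then show "norm (Q (blinfun_apply T' (blinfun_apply J0 x))) \<le> norm ?d"
        using norm_Q_le by metis
    qed
    then show ?thesis by simp
  qed
  have cQ: "norm (blinfun_apply c0 (blinfun_apply T' y)) \<le> \<beta> * norm y" if y: "blinfun_apply c0 y = 0" for y
  proof (rule ge)
    fix B
    have "blinfun_apply c0 (blinfun_apply T' y - blinfun_apply (amp s B) y) = blinfun_apply c0 (blinfun_apply T' y)"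
      by (simp add: amp_apply y blinfun.bilinear_simps)
    then show "norm (blinfun_apply c0 (blinfun_apply T' y)) \<le> norm (blinfun_apply T' y - blinfun_apply (amp s B) y)"
      using norm_c0_le by metis
  qed
  \<comment> \<open>The orbit of the perturbation \<open>x\<close> of \<open>y\<close> consists of the vectors
    \<open>\<sigma> *\<^sub>R J0 k + s *\<^sub>R J1 k\<close>; these are annihilated by \<open>L\<close>, a perturbation of \<open>Q\<close>.\<close>
  have QQ: "norm (Q (blinfun_apply T' y)) \<le> \<eta> * \<beta> * norm y" if y: "blinfun_apply c0 y = 0" for y
  proof -
    define k where "k = blinfun_apply c1 y"
    have k: "norm k \<le> norm y" unfolding k_def by (rule norm_c1_le)
    define x where "x = y + \<sigma> *\<^sub>R blinfun_apply J0 k"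
    define L where "L m = Q m - \<sigma> *\<^sub>R blinfun_apply J1 (blinfun_apply c0 m)" for m
    have L: "norm (L m) \<le> (1 + \<sigma>) * norm m" for m
    proof -
      have "norm (L m) \<le> norm (Q m) + norm (\<sigma> *\<^sub>R blinfun_apply J1 (blinfun_apply c0 m))"
        unfolding L_def by (rule norm_triangle_ineq4)
      also have "\<dots> \<le> norm m + \<sigma> * norm m"
        using \<sigma> norm_Q_le[of m] norm_c0_le[of m] by (intro add_mono) simp_all
      finally show ?thesis by (simp add: algebra_simps)
    qed
    have cx: "blinfun_apply c0 x = \<sigma> *\<^sub>R k" "blinfun_apply c1 x = k"
      by (simp_all add: x_def k_def y blinfun.bilinear_simps)
    have "norm (L (blinfun_apply T' x)) / (1 + \<sigma>) \<le> \<beta> * norm x"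
    proof (rule ge)
      fix B
      have "L (blinfun_apply (amp s B) x) = 0"
        unfolding L_def amp_apply cx
        by (simp add: Q_linear blinfun.bilinear_simps \<sigma>)
      then have "L (blinfun_apply T' x - blinfun_apply (amp s B) x) = L (blinfun_apply T' x)"
        by (simp add: L_def Q_linear blinfun.bilinear_simps algebra_simps)
      then have "norm (L (blinfun_apply T' x)) \<le> (1 + \<sigma>) * norm (blinfun_apply T' x - blinfun_apply (amp s B) x)"
        using L by metis
      then show "norm (L (blinfun_apply T' x)) / (1 + \<sigma>) \<le> norm (blinfun_apply T' x - blinfun_apply (amp s B) x)"
        using \<sigma> by (simp add: field_simps)
    qed
    moreover have "norm x \<le> (1 + \<sigma>) * norm y"
    proof -
      have "norm x \<le> norm y + \<sigma> * norm k"
        using norm_triangle_ineq[of y "\<sigma> *\<^sub>R blinfun_apply J0 k"] \<sigma> by (simp add: x_def)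
      also have "\<dots> \<le> norm y + \<sigma> * norm y" using k \<sigma> by (intro add_left_mono mult_left_mono) simp_all
      finally show ?thesis by (simp add: algebra_simps)
    qed
    ultimately have "norm (L (blinfun_apply T' x)) / (1 + \<sigma>) \<le> \<beta> * ((1 + \<sigma>) * norm y)"
      using \<beta> by (meson mult_left_mono order_trans)
    then have Lx: "norm (L (blinfun_apply T' x)) \<le> (1 + \<sigma>) * (\<beta> * ((1 + \<sigma>) * norm y))"
      using \<sigma> by (simp add: pos_divide_le_eq mult.commute)
    \<comment> \<open>Undoing the two perturbations leaves two error terms with factor
      \<open>\<sigma>\<close>. The cleared corner lets \<open>cQ\<close> bound the first, and
      \<open>QJ\<close> bounds the second.\<close>
    have "blinfun_apply c0 (blinfun_apply T' x) = blinfun_apply c0 (blinfun_apply T' y)"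
      by (simp add: x_def blinfun.bilinear_simps T'00)
    then have "Q (blinfun_apply T' y) = L (blinfun_apply T' x)
        + \<sigma> *\<^sub>R blinfun_apply J1 (blinfun_apply c0 (blinfun_apply T' y))
        - \<sigma> *\<^sub>R Q (blinfun_apply T' (blinfun_apply J0 k))"
      by (simp add: L_def) (simp add: x_def Q_linear blinfun.bilinear_simps)
    then have "norm (Q (blinfun_apply T' y)) \<le> norm (L (blinfun_apply T' x))
        + norm (\<sigma> *\<^sub>R blinfun_apply J1 (blinfun_apply c0 (blinfun_apply T' y)))
        + norm (\<sigma> *\<^sub>R Q (blinfun_apply T' (blinfun_apply J0 k)))"
      by (metis norm_triangle_le_diff norm_triangle_ineq add_right_mono)
    also have "\<dots> \<le> (1 + \<sigma>) * (\<beta> * ((1 + \<sigma>) * norm y)) + \<sigma> * (\<beta> * norm y) + \<sigma> * (\<beta> * norm y)"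
    proof (intro add_mono Lx)
      show "norm (\<sigma> *\<^sub>R blinfun_apply J1 (blinfun_apply c0 (blinfun_apply T' y))) \<le> \<sigma> * (\<beta> * norm y)"
        using cQ[OF y] \<sigma> by simp
      have "norm (Q (blinfun_apply T' (blinfun_apply J0 k))) \<le> \<beta> * norm y"
        using QJ[of k] mult_left_mono[OF k \<beta>] by linarith
      then show "norm (\<sigma> *\<^sub>R Q (blinfun_apply T' (blinfun_apply J0 k))) \<le> \<sigma> * (\<beta> * norm y)"
        using \<sigma> by simp
    qed
    also have "\<dots> = \<eta> * \<beta> * norm y" unfolding \<eta>_def \<sigma>(2)[symmetric] by (simp add: algebra_simps)
    finally show ?thesis .
  qed
  define g where "g = sqrt 2 * \<eta> * \<beta>"
  have g: "0 \<le> g" using \<eta> \<beta> by (simp add: g_def)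
  have \<beta>\<eta>: "\<beta> \<le> \<eta> * \<beta>" using \<eta> \<beta> mult_right_mono[of 1 \<eta> \<beta>] by simp
  \<comment> \<open>The row estimate splits the input and uses \<open>norm_sum_le\<close>; the
    column estimate below splits the output and uses Pythagoras.\<close>
  have row: "norm (Q (blinfun_apply T' x)) \<le> g * norm x" for x
  proof -
    have "blinfun_apply T' x = blinfun_apply T' (blinfun_apply J0 (blinfun_apply c0 x)) + blinfun_apply T' (Q x)"
      by (metis J0_c0_plus_Q blinfun.add_right)
    then have "norm (Q (blinfun_apply T' x)) \<le> norm (Q (blinfun_apply T' (blinfun_apply J0 (blinfun_apply c0 x)))) + norm (Q (blinfun_apply T' (Q x)))"
      by (simp add: Q_linear norm_triangle_ineq)
    also have "\<dots> \<le> \<eta> * \<beta> * norm (blinfun_apply c0 x) + \<eta> * \<beta> * norm (Q x)"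
      by (intro add_mono QQ order_trans[OF QJ] mult_right_mono \<beta>\<eta>) simp_all
    also have "\<dots> = \<eta> * \<beta> * (norm (blinfun_apply c0 x) + norm (Q x))" by (simp add: algebra_simps)
    also have "\<dots> \<le> \<eta> * \<beta> * (sqrt 2 * norm x)"
      using \<eta> \<beta> by (intro mult_left_mono norm_sum_le) simp
    finally show ?thesis by (simp add: g_def mult_ac)
  qed
  have col: "norm (blinfun_apply T' (Q x)) \<le> g * norm (Q x)" for x
  proof (rule power2_le_imp_le)
    have "norm (blinfun_apply c0 (blinfun_apply T' (Q x))) \<le> \<eta> * \<beta> * norm (Q x)"
      by (intro order_trans[OF cQ] mult_right_mono \<beta>\<eta>) simp_all
    moreover have "norm (Q (blinfun_apply T' (Q x))) \<le> \<eta> * \<beta> * norm (Q x)" by (intro QQ) simp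
    ultimately have "(norm (blinfun_apply T' (Q x)))\<^sup>2 \<le> (\<eta> * \<beta> * norm (Q x))\<^sup>2 + (\<eta> * \<beta> * norm (Q x))\<^sup>2"
      unfolding pythagoras[of "blinfun_apply T' (Q x)"] by (intro add_mono power_mono) simp_all
    also have "\<dots> = (g * norm (Q x))\<^sup>2" by (simp add: g_def power_mult_distrib)
    finally show "(norm (blinfun_apply T' (Q x)))\<^sup>2 \<le> (g * norm (Q x))\<^sup>2" .
    show "0 \<le> g * norm (Q x)" using g by simp
  qed
  have "infdist T (amps s) / (1 + s) \<le> g"
  proof (rule dense_ge)
    fix r assume r: "g < r"
    then obtain B where B: "clinear_op B" "norm (T' - (J0 o\<^sub>L B o\<^sub>L c0)) \<le> r"
      using amps_parrott[OF T' r _ row col] g by auto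
    \<comment> \<open>Since the corner of \<open>T'\<close> is zero, the compression of the
      completed operator to the range of \<open>J0\<close> is -B, so \<open>B\<close> is bounded by
      \<open>r\<close> as well. Adding the entry \<open>s B\<close> therefore costs at most
      \<open>s * r\<close>.\<close>
    have nB: "norm (blinfun_apply B x) \<le> r * norm x" for x
    proof -
      have "- blinfun_apply B x = blinfun_apply c0 (blinfun_apply (T' - (J0 o\<^sub>L B o\<^sub>L c0)) (blinfun_apply J0 x))"
        by (simp add: blinfun.bilinear_simps T'00)
      then have "norm (blinfun_apply B x) \<le> norm (blinfun_apply (T' - (J0 o\<^sub>L B o\<^sub>L c0)) (blinfun_apply J0 x))"
        using norm_c0_le by (metis norm_minus_cancel)
      also have "\<dots> \<le> norm (T' - (J0 o\<^sub>L B o\<^sub>L c0)) * norm x"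
        using norm_blinfun[of "T' - (J0 o\<^sub>L B o\<^sub>L c0)" "blinfun_apply J0 x"] by simp
      also have "\<dots> \<le> r * norm x" using B(2) by (intro mult_right_mono) simp_all
      finally show ?thesis .
    qed
    have nJB: "norm (J1 o\<^sub>L B o\<^sub>L c1) \<le> r"
    proof (rule norm_blinfun_bound)
      show "0 \<le> r" using g r by simp
      then show "norm (blinfun_apply (J1 o\<^sub>L B o\<^sub>L c1) x) \<le> r * norm x" for x
        using nB[of "blinfun_apply c1 x"] mult_left_mono[OF norm_c1_le[of x], of r] by simp
    qed
    have "infdist T (amps s) \<le> dist T (amp s (B0 + B))"
      by (intro infdist_le amp_in_amps clinear_op_add B B0)
    also have "\<dots> = norm ((T' - (J0 o\<^sub>L B o\<^sub>L c0)) - s *\<^sub>R (J1 o\<^sub>L B o\<^sub>L c1))"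
      by (simp add: dist_norm T'_def amp_linear) (simp add: amp_def algebra_simps)
    also have "\<dots> \<le> norm (T' - (J0 o\<^sub>L B o\<^sub>L c0)) + norm (s *\<^sub>R (J1 o\<^sub>L B o\<^sub>L c1))"
      by (rule norm_triangle_ineq4)
    also have "\<dots> \<le> r + s * r"
      using B(2) mult_left_mono[OF nJB, of s] s by (intro add_mono) simp_all
    finally show "infdist T (amps s) / (1 + s) \<le> r" using s by (simp add: field_simps)
  qed
  then show ?thesis
    using s unfolding g_def \<eta>_def \<beta>_def \<sigma>_def by (simp add: pos_divide_le_eq mult_ac)
qed

lemma hr_const_amps_le:
  assumes "0 < s"
  shows "hr_const (amps s) \<le> ereal ((1 + s) * (sqrt 2 * (1 + 4 * sqrt s + s)))"
  using assms by (intro hr_const_le infdist_amps_le) simp_all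

end

section \<open>The tensor product\<close>

lemma clinear_op_eqI_dense:
  fixes A B :: "'a::complex_normed_vector \<Rightarrow>\<^sub>L 'b::complex_normed_vector"
  assumes "clinear_op A" "clinear_op B" "\<And>x. x \<in> G \<Longrightarrow> blinfun_apply A x = blinfun_apply B x"
    and "closure (cspan G) = UNIV"
  shows "A = B"
proof (rule blinfun_eqI)
  fix x
  let ?E = "{x. blinfun_apply A x = blinfun_apply B x}"
  have "complex_vector.subspace ?E"
    using assms(1,2)
    by (intro complex_vector.subspaceI) (simp_all add: blinfun.bilinear_simps clinear_opD)
  then have "cspan G \<subseteq> ?E" using assms(3) by (intro complex_vector.span_minimal) auto
  moreover have "closed ?E" by (intro closed_Collect_eq continuous_intros)
  ultimately have "closure (cspan G) \<subseteq> ?E" by (rule closure_minimal)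
  then show "blinfun_apply A x = blinfun_apply B x" using assms(4) by auto
qed

section \<open>The weak operator topology\<close>

lemma topspace_wot: "topspace wot = bounded_ops"
  unfolding wot_def by (auto intro!: exI[of _ bounded_ops] exI[of _ UNIV])

lemma openin_wot_vimage:
  assumes "open U"
  shows "openin wot {T \<in> bounded_ops. cinner (blinfun_apply T x) y \<in> U}"
  unfolding wot_def
proof (rule topology_generated_by_Basis, rule CollectI)
  show "\<exists>x' y' U'. {T \<in> bounded_ops. cinner (blinfun_apply T x) y \<in> U}
      = {T \<in> bounded_ops. cinner (blinfun_apply T x') y' \<in> U'} \<and> open U'"
    by (rule exI[of _ x], rule exI[of _ y], rule exI[of _ U], rule conjI[OF refl assms])
qed

lemma continuous_map_wot: "continuous_map wot euclidean (\<lambda>T. cinner (blinfun_apply T x) y)"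
  by (simp add: continuous_map topspace_wot openin_wot_vimage)

text \<open>Membership means W = amp s (c0 W J0), and this equation can be tested on matrix
  coefficients, which are WOT-continuous.\<close>

lemma (in two_isometries) wot_closed_amps: "wot closure_of amps s = amps s"
proof
  show "amps s \<subseteq> wot closure_of amps s"
    by (intro closure_of_subset) (auto simp: topspace_wot bounded_ops_iff amps_def clinear_amp)
  show "wot closure_of amps s \<subseteq> amps s"
  proof
    fix W assume W: "W \<in> wot closure_of amps s"
    then have clW: "clinear_op W"
      using closure_of_subset_topspace[of wot "amps s"] by (auto simp: topspace_wot bounded_ops_iff)
    define B where "B = c0 o\<^sub>L W o\<^sub>L J0"
    have B: "clinear_op B" unfolding B_def by (intro clinear_op_intros clW clinear_J clinear_c)
    have "W = amp s B"
    proof (intro blinfun_eqI cinner_eqI)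
      fix x y
      \<comment> \<open>The coefficient of \<open>A\<close> at \<open>x\<close>, \<open>y\<close>
        minus that of the amplification of its compression c0 A J0.\<close>
      define f where "f A = cinner (blinfun_apply A x) y
        - (cinner (blinfun_apply A (blinfun_apply J0 (blinfun_apply c0 x))) (blinfun_apply J0 (blinfun_apply c0 y))
           + cinner (blinfun_apply A (blinfun_apply J0 (blinfun_apply c1 x))) (s *\<^sub>R blinfun_apply J0 (blinfun_apply c1 y)))" for A
      have "continuous_map wot euclidean f"
        unfolding f_def by (intro continuous_map_diff continuous_map_add continuous_map_wot)
      then have "closedin wot {A \<in> topspace wot. f A \<in> {0}}"
        by (rule closedin_continuous_map_preimage) simp
      moreover have "f A = 0" if "A \<in> amps s" for A
        using that
        by (auto simp: amps_def f_def amp_apply cinner_add_left cinner_J cinner_scaleR_left cinner_scaleR_right blinfun.bilinear_simps)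
      then have "amps s \<subseteq> {A \<in> topspace wot. f A \<in> {0}}"
        by (auto simp: topspace_wot bounded_ops_iff amps_def clinear_amp)
      ultimately have "wot closure_of amps s \<subseteq> {A \<in> topspace wot. f A \<in> {0}}"
        by (intro closure_of_minimal)
      then have "f W = 0" using W by blast
      then show "cinner (blinfun_apply W x) y = cinner (blinfun_apply (amp s B) x) y"
        by (simp add: f_def amp_apply B_def cinner_add_left cinner_scaleR_left cinner_scaleR_right cinner_J cinner_J')
    qed
    then show "W \<in> amps s" using amp_in_amps[OF B] by simp
  qed
qed

text \<open>This resolves the description operator in \<open>diag_op\<close>: the sum of rank-one
  operators has the right values on the basis, and density of its span gives uniqueness.\<close>

lemma diag_T_eq:
  fixes e :: "nat \<Rightarrow> 'a::chilbert_space"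
  assumes "orthonormal_basis e"
  shows "diag_T e s = rank_one (e 0) (e 0) + s *\<^sub>R rank_one (e 1) (e 1)"
    (is "_ = ?D")
  unfolding diag_T_def diag_op_def
proof (rule the_equality)
  have clD: "clinear_op ?D" by (intro clinear_op_intros clinear_op_rank_one)
  have De: "blinfun_apply ?D (e n) = (if n = 0 then 1 else if n = 1 then complex_of_real s else 0) *\<^sub>C e n" for n
    using assms by (auto simp: orthonormal_basis_def blinfun.bilinear_simps rank_one_apply scaleC_of_real)
  then show "?D \<in> bounded_ops \<and> (\<forall>n. blinfun_apply ?D (e n)
      = (if n = 0 then 1 else if n = 1 then complex_of_real s else 0) *\<^sub>C e n)"
    using clD by (simp add: bounded_ops_iff)
  fix T assume T: "T \<in> bounded_ops \<and> (\<forall>n. blinfun_apply T (e n)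
      = (if n = 0 then 1 else if n = 1 then complex_of_real s else 0) *\<^sub>C e n)"
  show "T = ?D"
  proof (rule clinear_op_eqI_dense[OF _ clD])
    show "clinear_op T" using T by (simp add: bounded_ops_iff)
    show "blinfun_apply T x = blinfun_apply ?D x" if "x \<in> range e" for x
      using that T De by auto
    show "closure (cspan (range e)) = UNIV" using assms by (simp add: orthonormal_basis_def)
  qed
qed

section \<open>Elementary tensors and the identification of the tensor product space with
  \<open>amps\<close>\<close>

context
  fixes t :: "'h::chilbert_space \<Rightarrow> 'k::chilbert_space \<Rightarrow> 'x::chilbert_space"
  assumes t: "hilbert_tensor t"
begin

lemma tensor_add: "t (x + x') y = t x y + t x' y" "t x (y + y') = t x y + t x y'"
  and tensor_scaleC: "t (c *\<^sub>C x) y = c *\<^sub>C t x y" "t x (c *\<^sub>C y) = c *\<^sub>C t x y"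
  and cinner_tensor: "cinner (t x y) (t x' y') = cinner x x' * cinner y y'"
  and tensor_dense: "closure (cspan {t x y | x y. True}) = UNIV"
  using t by (simp_all add: hilbert_tensor_def)

lemma tensor_scaleR: "t (r *\<^sub>R x) y = r *\<^sub>R t x y" "t x (r *\<^sub>R y) = r *\<^sub>R t x y"
  by (metis scaleC_of_real tensor_scaleC)+

lemma norm_tensor: "norm (t x y) = norm x * norm y"
proof (rule power2_eq_imp_eq)
  show "(norm (t x y))\<^sup>2 = (norm x * norm y)\<^sup>2"
    using cinner_tensor[of x y x y]
    by (simp add: cinner_self power_mult_distrib flip: of_real_mult of_real_power)
qed simp_all

lemma tensor_left_apply: "blinfun_apply (Blinfun (t x)) y = t x y"
proof -
  have "bounded_linear (t x)"
    by (rule bounded_linear_intro[where K = "norm x"])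
       (simp_all add: tensor_add tensor_scaleR norm_tensor mult.commute)
  then show ?thesis by (rule bounded_linear_Blinfun_apply[THEN fun_cong])
qed

lemma two_isometries_tensor:
  assumes "orthonormal_basis e" "norm u = 1" "norm v = 1" "cinner u v = 0"
  shows "two_isometries (Blinfun (t (e (0::nat)))) (Blinfun (t (e 1))) u v"
proof -
  have e: "cinner (e i) (e j) = (if i = j then 1 else 0)" for i j
    using assms(1) by (simp add: orthonormal_basis_def)
  show ?thesis
    by unfold_locales
       (simp_all add: assms clinear_op_def tensor_left_apply tensor_scaleC Re_cinner[symmetric] cinner_tensor e)
qed

text \<open>The scalar in a multiple of T_s can be absorbed into \<open>B\<close>, so the generating
  operators already form the space \<open>amps s\<close>. It is a complex subspace and WOT-closed,
  so span and closure add nothing.\<close>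

lemma wot_tensor_diag_T:
  assumes e: "orthonormal_basis e"
    and iso: "two_isometries (Blinfun (t (e (0::nat)))) (Blinfun (t (e 1))) u v"
  shows "wot_tensor t (scalar_multiples (diag_T e s)) bounded_ops
    = two_isometries.amps (Blinfun (t (e 0))) (Blinfun (t (e 1))) s"
proof -
  interpret two_isometries "Blinfun (t (e 0))" "Blinfun (t (e 1))" u v by fact
  \<comment> \<open>This keeps \<open>e 1\<close> from being rewritten to \<open>e (Suc 0)\<close>,
    which would no longer match the interpretation.\<close>
  note One_nat_def [simp del]
  define D where "D = diag_T e s"
  have D: "blinfun_apply D x = cinner x (e 0) *\<^sub>C e 0 + s *\<^sub>R cinner x (e 1) *\<^sub>C e 1" for x
    by (simp add: D_def diag_T_eq[OF e] blinfun.bilinear_simps rank_one_apply)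
  have c: "blinfun_apply c0 (t x y) = cinner x (e 0) *\<^sub>C y" "blinfun_apply c1 (t x y) = cinner x (e 1) *\<^sub>C y" for x y
    by (rule cinner_eqI, simp add: cinner_J'[symmetric] tensor_left_apply cinner_tensor cinner_scaleC_left)+
  have amp: "blinfun_apply (amp s B) (t x y) = t (blinfun_apply D x) (blinfun_apply B y)" if "clinear_op B" for B x y
    by (simp add: amp_apply c clinear_opD[OF that] tensor_left_apply D tensor_add tensor_scaleC tensor_scaleR)
  have gen: "{W \<in> bounded_ops. \<exists>A\<in>scalar_multiples D. \<exists>B\<in>bounded_ops. \<forall>x y.
        blinfun_apply W (t x y) = t (blinfun_apply A x) (blinfun_apply B y)} = amps s" (is "?L = _")
  proof (intro equalityI subsetI)
    fix W assume "W \<in> ?L"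
    then obtain k B where W: "clinear_op W" "clinear_op B"
      "\<And>x y. blinfun_apply W (t x y) = t (blinfun_apply (k *\<^sub>C D) x) (blinfun_apply B y)"
      by (auto simp: scalar_multiples_def bounded_ops_iff)
    have "W = amp s (k *\<^sub>C B)"
    proof (rule clinear_op_eqI_dense[OF W(1) _ _ tensor_dense])
      show "clinear_op (amp s (k *\<^sub>C B))" by (intro clinear_amp clinear_op_intros W)
      show "blinfun_apply W z = blinfun_apply (amp s (k *\<^sub>C B)) z" if "z \<in> {t x y | x y. True}" for z
        using that W(2) by (auto simp: W(3) amp clinear_op_scaleC scaleC_blinfun.rep_eq tensor_scaleC)
    qed
    then show "W \<in> amps s" using amp_in_amps[OF clinear_op_scaleC[OF W(2)]] by simp
  next
    fix W assume "W \<in> amps s"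
    then obtain B where B: "clinear_op B" "W = amp s B" by (auto simp: amps_def)
    have "D \<in> scalar_multiples D"
      unfolding scalar_multiples_def by (metis complex_vector.scale_one rangeI)
    with B show "W \<in> ?L" by (auto simp: bounded_ops_iff clinear_amp amp intro!: bexI[of _ D] bexI[of _ B])
  qed
  have "cspan (amps s) = amps s"
    using subspace_amps complex_vector.span_eq_iff by blast
  then show ?thesis
    unfolding wot_tensor_def D_def[symmetric] gen by (simp only: wot_closed_amps)
qed

end

text \<open>Two Gram-Schmidt steps: neither the empty set nor a single vector spans an
  infinite-dimensional space.\<close>

lemma obtain_orthonormal_pair:
  assumes "\<nexists>F :: 'k::complex_inner set. finite F \<and> cspan F = UNIV"
  obtains u v :: "'k::complex_inner" where "norm u = 1" "norm v = 1" "cinner u v = 0"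
proof -
  have "cspan ({}::'k set) \<noteq> UNIV" using assms by blast
  then obtain a :: 'k where a: "a \<noteq> 0" by (auto simp: complex_vector.span_empty)
  define u where "u = (1 / norm a) *\<^sub>R a"
  have u: "norm u = 1" using a by (simp add: u_def)
  have "cspan {u} \<noteq> UNIV" using assms by blast
  then obtain b where b: "b \<notin> cspan {u}" by blast
  define k where "k = cinner b u"
  define z where "z = b - k *\<^sub>C u"
  have "k *\<^sub>C u \<in> cspan {u}"
    by (intro complex_vector.span_scale complex_vector.span_base) simp
  with b have "z \<noteq> 0" by (auto simp: z_def)
  define v where "v = (1 / norm z) *\<^sub>R z"
  have v: "norm v = 1" using \<open>z \<noteq> 0\<close> by (simp add: v_def)
  have "cinner z u = 0" by (simp add: z_def k_def cinner_diff_left cinner_scaleC_left cinner_self u)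
  then have "cinner u z = 0" by (metis cinner_commute complex_cnj_zero)
  then have "cinner u v = 0" by (simp add: v_def cinner_scaleR_right)
  then show ?thesis by (rule that[OF u v])
qed

theorem proposition6p17:
  fixes e :: "nat \<Rightarrow> 'h::chilbert_space"
    and t :: "'h \<Rightarrow> 'k::chilbert_space \<Rightarrow> 'hk::chilbert_space"
  assumes "orthonormal_basis e"
    and "separable_space (euclidean :: 'k topology)"
    and "\<nexists>F :: 'k set. finite F \<and> cspan F = UNIV"
    and "hilbert_tensor t"
  shows "(\<exists>L. ((\<lambda>s. complete_hr_const t (scalar_multiples (diag_T e s))) \<longlongrightarrow> L) (at_right 0)
            \<and> ereal (sqrt 2) \<le> L \<and> L \<le> ereal (5 / 2))
       \<and> complete_hr_const t (scalar_multiples (diag_T e 0)) = 1"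
proof -
  obtain u v :: 'k where uv: "norm u = 1" "norm v = 1" "cinner u v = 0"
    by (rule obtain_orthonormal_pair[OF assms(3)])
  interpret two_isometries "Blinfun (t (e 0))" "Blinfun (t (e 1))" u v
    by (rule two_isometries_tensor[OF assms(4,1) uv])
  have eq: "complete_hr_const t (scalar_multiples (diag_T e s)) = hr_const (amps s)" for s
    unfolding complete_hr_const_def
    using wot_tensor_diag_T[OF assms(4,1) two_isometries_axioms] by simp
  \<comment> \<open>Both bounds converge to \<open>sqrt 2\<close>, since 2 / sqrt 2 = sqrt 2 and the
    error factors of the upper bound tend to 1. This value is the witness for
    \<open>L\<close>.\<close>
  have "((\<lambda>s. hr_const (amps s)) \<longlongrightarrow> ereal (sqrt 2)) (at_right 0)"
  proof (rule tendsto_sandwich)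
    have "((\<lambda>s::real. 2 / (sqrt 2 + s)) \<longlongrightarrow> 2 / (sqrt 2 + 0)) (at_right 0)"
      by (intro tendsto_intros) simp
    then show "((\<lambda>s. ereal (2 / (sqrt 2 + s))) \<longlongrightarrow> ereal (sqrt 2)) (at_right 0)"
      by (simp add: real_div_sqrt)
    have "((\<lambda>s::real. (1 + s) * (sqrt 2 * (1 + 4 * sqrt s + s))) \<longlongrightarrow> (1 + 0) * (sqrt 2 * (1 + 4 * sqrt 0 + 0))) (at_right 0)"
      by (intro tendsto_intros)
    then show "((\<lambda>s. ereal ((1 + s) * (sqrt 2 * (1 + 4 * sqrt s + s)))) \<longlongrightarrow> ereal (sqrt 2)) (at_right 0)"
      by simp
    show "\<forall>\<^sub>F s in at_right 0. ereal (2 / (sqrt 2 + s)) \<le> hr_const (amps s)"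
      using eventually_at_right_less by eventually_elim (rule hr_const_amps_ge)
    show "\<forall>\<^sub>F s in at_right 0. hr_const (amps s) \<le> ereal ((1 + s) * (sqrt 2 * (1 + 4 * sqrt s + s)))"
      using eventually_at_right_less by eventually_elim (rule hr_const_amps_le)
  qed
  moreover have "sqrt 2 \<le> 5 / 2" by (rule real_le_lsqrt) (simp_all add: power2_eq_square)
  moreover have "hr_const (amps 0) = 1"
    using hr_const_amps_0_le hr_const_amps_0_ge by (rule antisym)
  ultimately show ?thesis unfolding eq by auto
qed

end
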